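(* Let $H$ be a forest with connected components the trees $T_1,\dots,T_k$, and let $b$ be a positive integer. Consider $(1:b)$ Client-Waiter vertex games. (1) If $H$ is a tree ($k=1$), there exists a tree $T$ such that Client wins the $(1:b)$ Client-Waiter vertex $H$-game played on $T$. (2) For each $i\in[k]$ let $T^{(i)}_{\min}$ be a tree with the minimum number of vertices such that Client wins the $(1:b)$ Client-Waiter vertex $T_i$-game played on it, and let $T_{\max}$ be one of the trees $T^{(i)}_{\min}$ with the maximum number of vertices; write $v=v(T_{\max})$, $e=e(T_{\max})$. Then for $G\sim G(n,p)$: if $p=\omega(n^{-v/e})$ then w.h.p. Client wins the $(1:b)$ Client-Waiter vertex $H$-game on $G$, and if $p=o(n^{-v/e})$ then w.h.p. Waiter wins it.
   Context: The $(1:b)$ Client-Waiter vertex $H$-game on a graph $G$: in each round Waiter offers a set of $t$ previously unclaimed vertices with $1\le t\le b+1$; Client claims one of them and Waiter claims the rest; in the last round Client claims one of the remaining vertices and Waiter the rest. Client wins if the subgraph of $G$ induced by his vertices contains a (not necessarily induced) copy of $H$; otherwise Waiter wins. $G(n,p)$ is the binomial random graph; "w.h.p." means with probability tending to 1 as $n\to\infty$. *)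

theory Defs
  imports Complex_Main "HOL-Library.Landau_Symbols"
begin

type_synonym 'a graph = "'a set \<times> 'a set set"

definition verts :: "'a graph \<Rightarrow> 'a set" where "verts G = fst G"
definition edges :: "'a graph \<Rightarrow> 'a set set" where "edges G = snd G"

definition wf_graph :: "'a graph \<Rightarrow> bool" where
  "wf_graph G \<longleftrightarrow> finite (verts G) \<and> (\<forall>e\<in>edges G. e \<subseteq> verts G \<and> card e = 2)"

definition adj :: "'a graph \<Rightarrow> 'a \<Rightarrow> 'a \<Rightarrow> bool" where
  "adj G u v \<longleftrightarrow> {u, v} \<in> edges G"

definition connected_graph :: "'a graph \<Rightarrow> bool" where
  "connected_graph G \<longleftrightarrow> (\<forall>u\<in>verts G. \<forall>v\<in>verts G. (adj G)\<^sup>*\<^sup>* u v)"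

definition has_cycle :: "'a graph \<Rightarrow> bool" where
  "has_cycle G \<longleftrightarrow> (\<exists>xs. length xs \<ge> 3 \<and> distinct xs \<and> set xs \<subseteq> verts G \<and>
      (\<forall>i<length xs. adj G (xs ! i) (xs ! ((i + 1) mod length xs))))"

definition is_forest :: "'a graph \<Rightarrow> bool" where
  "is_forest G \<longleftrightarrow> wf_graph G \<and> \<not> has_cycle G"

definition is_tree :: "'a graph \<Rightarrow> bool" where
  "is_tree G \<longleftrightarrow> is_forest G \<and> verts G \<noteq> {} \<and> connected_graph G"

definition induced :: "'a graph \<Rightarrow> 'a set \<Rightarrow> 'a graph" where
  "induced G S = (S, {e\<in>edges G. e \<subseteq> S})"

definition components :: "'a graph \<Rightarrow> 'a set set" where
  "components G = {{u\<in>verts G. (adj G)\<^sup>*\<^sup>* v u} | v. v \<in> verts G}"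

definition contains_copy :: "'a graph \<Rightarrow> 'b graph \<Rightarrow> 'b set \<Rightarrow> bool" where
  "contains_copy H G S \<longleftrightarrow> (\<exists>f. inj_on f (verts H) \<and> f ` verts H \<subseteq> S \<and>
      (\<forall>e\<in>edges H. f ` e \<in> edges G))"

text \<open>cw_pos b H G U C: Client can force a win from the position in which U is the set of
  unclaimed vertices and C is the set of Client's vertices. In each round Waiter offers a
  nonempty set A of at most b+1 unclaimed vertices, Client takes one, Waiter the rest.\<close>
inductive cw_pos :: "nat \<Rightarrow> 'a graph \<Rightarrow> 'b graph \<Rightarrow> 'b set \<Rightarrow> 'b set \<Rightarrow> bool"
  for b H G where
  game_over: "contains_copy H G C \<Longrightarrow> cw_pos b H G {} C"
| round: "U \<noteq> {} \<Longrightarrow>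
    (\<forall>A. A \<subseteq> U \<and> A \<noteq> {} \<and> finite A \<and> card A \<le> b + 1 \<longrightarrow>
        (\<exists>x\<in>A. cw_pos b H G (U - A) (insert x C))) \<Longrightarrow> cw_pos b H G U C"

definition client_wins :: "nat \<Rightarrow> 'a graph \<Rightarrow> 'b graph \<Rightarrow> bool" where
  "client_wins b H G \<longleftrightarrow> cw_pos b H G (verts G) {}"

definition min_client_tree :: "nat \<Rightarrow> 'a graph \<Rightarrow> nat graph \<Rightarrow> bool" where
  "min_client_tree b H T \<longleftrightarrow> is_tree T \<and> client_wins b H T \<and>
     (\<forall>T'::nat graph. is_tree T' \<and> client_wins b H T' \<longrightarrow> card (verts T) \<le> card (verts T'))"

definition is_Tmax :: "nat \<Rightarrow> 'a graph \<Rightarrow> nat graph \<Rightarrow> bool" where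
  "is_Tmax b H T \<longleftrightarrow> (\<exists>C\<in>components H. min_client_tree b (induced H C) T) \<and>
     (\<forall>C\<in>components H. \<forall>T'. min_client_tree b (induced H C) T' \<longrightarrow>
        card (verts T') \<le> card (verts T))"

definition all_pairs :: "nat \<Rightarrow> nat set set" where
  "all_pairs n = {e. e \<subseteq> {0..<n} \<and> card e = 2}"

definition prob_Gnp :: "nat \<Rightarrow> real \<Rightarrow> (nat graph \<Rightarrow> bool) \<Rightarrow> real" where
  "prob_Gnp n p P = (\<Sum>E\<in>Pow (all_pairs n).
      if P ({0..<n}, E) then p ^ card E * (1 - p) ^ (card (all_pairs n) - card E) else 0)"

end

theory Submission
  imports Defs "HOL-Library.FuncSet" "HOL-Library.Disjoint_Sets" "HOL-Library.Nat_Bijection"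
begin

text \<open>
  A potential argument shows that Client can win on a board \<open>V\<close> and, at the same time, on at least one
  of many disjoint boards on each of which he wins separately.  Hanging enough leaves on every vertex of
  a tree that is good for \<open>H\<close> therefore gives a tree that is good for \<open>H\<close> plus a leaf, and a graph
  with many disjoint copies of all the minimal trees is good for the whole forest.

  Above the threshold such copies exist by the second moment method, applied to transversal copies in
  disjoint vertex classes of linear size.  Below it, by a first moment computation every component of
  \<open>G(n,p)\<close> is a tree with fewer than \<open>v\<close> vertices; by minimality Client loses on each of
  them for the component of \<open>H\<close> that defines \<open>T\<^sub>m\<^sub>a\<^sub>x\<close>, and since that component is connected, Waiter may
  play the components of \<open>G(n,p)\<close> one by one.
\<close>

subsection \<open>Playing on several boards\<close>

text \<open>One answer has to serve several boards: an offer can damage up to \<open>b + 1\<close>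
  of them while Client replies in only one. Auxiliary boards are therefore expendable, and what
  counts is that they are numerous compared with \<open>b * card V * (b + 1) ^ s\<close>, where
  \<open>s\<close> bounds their size. The exponent comes from the identity
  \<open>n ^ k * p ^ (k - 1) = n * (n * p) ^ (k - 1)\<close>: it is monotone in \<open>k\<close>, so
  among the trees with at most \<open>v\<close> vertices the expected counts are controlled by the
  extremes \<open>k = 1\<close> and \<open>k = v\<close>. Since \<open>e = v - 1\<close>, the ratio
  \<open>v / e\<close> exceeds 1, so below the threshold \<open>n * p\<close> also tends to 0; this
  excludes sets of \<open>l < v\<close> vertices with at least \<open>l\<close> edges, and with them
  the short cycles. Fixing disjoint vertex classes in advance makes the copies that are found
  disjoint automatically, and turns the overlap of two copies into agreement of two functions. The
  two sides use maximality differently: Client needs every component's minimal tree to have at most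
  \<open>v\<close> vertices, Waiter needs a single component whose minimal tree has exactly
  \<open>v\<close>.\<close>

inductive client_forces :: "nat \<Rightarrow> ('v set \<Rightarrow> bool) \<Rightarrow> 'v set \<Rightarrow> 'v set \<Rightarrow> bool"
  for b W where
  over: "W C \<Longrightarrow> client_forces b W {} C"
| offer: "U \<noteq> {} \<Longrightarrow>
    (\<And>A. \<lbrakk>A \<subseteq> U; A \<noteq> {}; finite A; card A \<le> b + 1\<rbrakk> \<Longrightarrow>
        \<exists>x\<in>A. client_forces b W (U - A) (insert x C)) \<Longrightarrow> client_forces b W U C"

lemma client_forces_empty_iff: "client_forces b W {} C \<longleftrightarrow> W C"
  by (subst client_forces.simps) auto

lemma client_forces_step:
  assumes "client_forces b W U C" "A \<subseteq> U" "A \<noteq> {}" "finite A" "card A \<le> b + 1"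
  obtains x where "x \<in> A" "client_forces b W (U - A) (insert x C)"
  using assms(1)
  by (cases rule: client_forces.cases) (use assms that in auto)

text \<open>The free goal \<open>W\<close> is needed because Client pursues goals on several boards
  at once, and such conjunctions of localised goals are not of the form
  \<open>contains_copy H G\<close>.\<close>

lemma cw_pos_iff_client_forces: "cw_pos b H G U C \<longleftrightarrow> client_forces b (contains_copy H G) U C"
proof
  show "client_forces b (contains_copy H G) U C" if "cw_pos b H G U C"
    using that
  proof induction
    case (round U C)
    then show ?case by (intro client_forces.offer) auto
  qed (rule client_forces.over)
  show "cw_pos b H G U C" if "client_forces b (contains_copy H G) U C"
    using that
  proof induction
    case (offer U C)
    then show ?case by (intro cw_pos.round) auto
  qed (rule cw_pos.game_over)
qed

text \<open>Client ends with a subset of \<open>U \<union> C\<close>, so the implication between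
  goals is required only there; later this places copies inside \<open>verts G\<close>.\<close>

lemma client_forces_mono:
  assumes "client_forces b W U C" "\<And>S. S \<subseteq> U \<union> C \<Longrightarrow> W S \<Longrightarrow> W' S"
  shows "client_forces b W' U C"
  using assms
proof induction
  case (over C)
  then show ?case by (simp add: client_forces.over)
next
  case (offer U C)
  show ?case
  proof (rule client_forces.offer[OF offer(1)])
    fix A assume A: "A \<subseteq> U" "A \<noteq> {}" "finite A" "card A \<le> b + 1"
    from offer(2)[OF A] obtain x where x: "x \<in> A"
      "(\<And>S. S \<subseteq> U - A \<union> insert x C \<Longrightarrow> W S \<Longrightarrow> W' S) \<Longrightarrow> client_forces b W' (U - A) (insert x C)"
      by blast
    have "client_forces b W' (U - A) (insert x C)"
      by (rule x(2), rule offer.prems) (use x(1) A(1) in auto)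
    with x(1) show "\<exists>x\<in>A. client_forces b W' (U - A) (insert x C)" by blast
  qed
qed

text \<open>Offers are pulled back along \<open>f\<close>, injectivity preserving their size. The
  fixed set \<open>D\<close> carries injectivity through the induction while the position
  changes.\<close>

lemma client_forces_image:
  assumes "client_forces b W U C" "inj_on f D" "U \<union> C \<subseteq> D"
    "\<And>S. S \<subseteq> U \<union> C \<Longrightarrow> W S \<Longrightarrow> W' (f ` S)"
  shows "client_forces b W' (f ` U) (f ` C)"
  using assms
proof induction
  case (over C)
  then show ?case by (simp add: client_forces.over)
next
  case (offer U C)
  show ?case
  proof (rule client_forces.offer)
    fix A' assume A': "A' \<subseteq> f ` U" "A' \<noteq> {}" "finite A'" "card A' \<le> b + 1"
    have inj: "inj_on f U" using offer.prems inj_on_subset by blast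
    obtain A where A: "A \<subseteq> U" "A' = f ` A"
      using A'(1) by (meson subset_image_iff)
    have injA: "inj_on f A" using A(1) inj inj_on_subset by blast
    have A2: "A \<noteq> {}" "finite A" "card A \<le> b + 1"
      using A A' injA by (auto simp: card_image finite_image_iff)
    from offer(2)[OF A(1) A2] obtain x where x: "x \<in> A"
      "inj_on f D \<Longrightarrow> U - A \<union> insert x C \<subseteq> D \<Longrightarrow> (\<And>S. S \<subseteq> U - A \<union> insert x C \<Longrightarrow> W S \<Longrightarrow> W' (f ` S))
         \<Longrightarrow> client_forces b W' (f ` (U - A)) (f ` insert x C)"
      by blast
    have "client_forces b W' (f ` (U - A)) (f ` insert x C)"
      by (rule x(2), rule offer.prems(1)) (use offer.prems x(1) A(1) in blast)+
    moreover have "f ` (U - A) = f ` U - A'"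
      using A inj by (simp add: inj_on_image_set_diff)
    ultimately show "\<exists>x\<in>A'. client_forces b W' (f ` U - A') (insert x (f ` C))"
      using x(1) A(2) by auto
  qed (use offer in auto)
qed

text \<open>Offers of every size from 1 to \<open>b + 1\<close> are legal, so the trace
  \<open>A \<inter> V\<close> of an offer, if nonempty, is a legal offer on \<open>V\<close> and can
  be answered there. If the trace is empty, any answer leaves the position on \<open>V\<close> as it
  was.\<close>

lemma client_forces_restrict:
  assumes "finite U" "client_forces b W (U \<inter> V) (C \<inter> V)"
  shows "client_forces b (\<lambda>S. W (S \<inter> V)) U C"
  using assms
proof (induction "card U" arbitrary: U C rule: less_induct)
  case less
  show ?case
  proof (cases "U = {}")
    case True
    then show ?thesis using less.prems by (simp add: client_forces_empty_iff)
  next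
    case False
    show ?thesis
    proof (rule client_forces.offer[OF False])
      fix A assume A: "A \<subseteq> U" "A \<noteq> {}" "finite A" "card A \<le> b + 1"
      have lt: "card (U - A) < card U" "finite (U - A)"
        using A less.prems by (auto intro!: psubset_card_mono)
      show "\<exists>x\<in>A. client_forces b (\<lambda>S. W (S \<inter> V)) (U - A) (insert x C)"
      proof (cases "A \<inter> V = {}")
        case True
        obtain x where "x \<in> A" using A by auto
        then have "(U - A) \<inter> V = U \<inter> V" "insert x C \<inter> V = C \<inter> V" using True by auto
        then show ?thesis using less.hyps[OF lt, of "insert x C"] less.prems \<open>x \<in> A\<close> by auto
      next
        case False
        have "card (A \<inter> V) \<le> b + 1"
          using A(3,4) by (meson Int_lower1 card_mono le_trans)
        then obtain x where x: "x \<in> A \<inter> V" "client_forces b W (U \<inter> V - A \<inter> V) (insert x (C \<inter> V))"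
          using client_forces_step[OF less.prems(2), of "A \<inter> V"] A False by auto
        have "(U - A) \<inter> V = U \<inter> V - A \<inter> V" "insert x C \<inter> V = insert x (C \<inter> V)" using x by auto
        then show ?thesis using less.hyps[OF lt, of "insert x C"] x by auto
      qed
    qed
  qed
qed

text \<open>Choosing a point of \<open>A\<close> in every board gives an injection of
  \<open>J\<close> into \<open>A\<close>. It bounds the number of boards that a single offer can
  damage.\<close>

lemma card_hit_le:
  assumes "finite A" "disjoint_family_on B J" "\<And>j. j \<in> J \<Longrightarrow> A \<inter> B j \<noteq> {}"
  shows "finite J \<and> card J \<le> card A"
proof -
  obtain g where g: "\<And>j. j \<in> J \<Longrightarrow> g j \<in> A \<inter> B j"
  proof -
    have "\<forall>j\<in>J. \<exists>x. x \<in> A \<inter> B j" using assms(3) by blast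
    then show thesis using that by (metis (no_types) bchoice)
  qed
  have inj: "inj_on g J"
  proof (rule inj_onI)
    fix i j assume "i \<in> J" "j \<in> J" "g i = g j"
    then show "i = j" using g[of i] g[of j] assms(2) unfolding disjoint_family_on_def by auto
  qed
  moreover have "g ` J \<subseteq> A" using g by auto
  ultimately show ?thesis using assms(1)
    by (meson card_inj_on_le inj_on_finite)
qed

text \<open>Client answers inside \<open>V\<close> whenever he can, and otherwise in the offered board that has the
  fewest free vertices; every other board that is touched is given up.  An answer on a board
  multiplies its weight \<open>(b + 1)\<close>-fold, which makes up for the at most \<open>b\<close> boards of smaller weight
  lost in that round, whereas a round spent on \<open>V\<close> costs at most \<open>b\<close>.\<close>

lemma client_forces_both_pos:
  fixes J :: "'j set" and U :: "'v set"
  assumes "finite U" "finite J" "disjoint_family_on B J" "\<And>j. j \<in> J \<Longrightarrow> V \<inter> B j = {}"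
    and "client_forces b W (U \<inter> V) (C \<inter> V)"
    and "\<And>j. j \<in> J \<Longrightarrow> client_forces b (W' j) (U \<inter> B j) (C \<inter> B j)"
    and "real b * real (card (U \<inter> V)) < (\<Sum>j\<in>J. (1 / (real b + 1)) ^ card (U \<inter> B j))"
  shows "client_forces b (\<lambda>S. W (S \<inter> V) \<and> (\<exists>j\<in>J. W' j (S \<inter> B j))) U C"
  using assms
proof (induction "card U" arbitrary: U C J rule: less_induct)
  case less
  note prems = less.prems
  let ?goal = "\<lambda>J. \<lambda>S. W (S \<inter> V) \<and> (\<exists>j\<in>J. W' j (S \<inter> B j))"
  let ?w = "\<lambda>U j. (1 / (real b + 1)) ^ card (U \<inter> B j)"
  have w01: "0 \<le> ?w U j" "?w U j \<le> 1" for U :: "'v set" and j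
    by (auto intro: power_le_one)
  show ?case
  proof (cases "U = {}")
    case True
    \<comment> \<open>With no vertices left the inequality says that the sum over \<open>J\<close>
      is positive, so some board has survived.\<close>
    then have "J \<noteq> {}" using prems(7) by auto
    then show ?thesis using prems True by (auto simp: client_forces_empty_iff)
  next
    case False
    show ?thesis
    proof (rule client_forces.offer[OF False])
      fix A assume A: "A \<subseteq> U" "A \<noteq> {}" "finite A" "card A \<le> b + 1"
      have lt: "card (U - A) < card U" "finite (U - A)"
        using A prems(1) by (auto intro!: psubset_card_mono)
      have cardA: "card (A \<inter> X) \<le> b + 1" for X
        using A(3,4) by (meson Int_lower1 card_mono le_trans)
      \<comment> \<open>Boards may be dropped: winning one of the boards \<open>J'\<close> still
        alive is winning one of \<open>J\<close>, so it suffices to restore the potential inequality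
        for \<open>J'\<close>.\<close>
      have concl: "\<exists>x\<in>A. client_forces b (?goal J) (U - A) (insert x C)"
        if "x \<in> A" "J' \<subseteq> J" "client_forces b W ((U - A) \<inter> V) (insert x C \<inter> V)"
          "\<And>j. j \<in> J' \<Longrightarrow> client_forces b (W' j) ((U - A) \<inter> B j) (insert x C \<inter> B j)"
          "real b * real (card ((U - A) \<inter> V)) < (\<Sum>j\<in>J'. ?w (U - A) j)" for x J'
      proof -
        have "client_forces b (?goal J') (U - A) (insert x C)"
        proof (rule less.hyps[OF lt])
          show "finite J'" using that(2) prems(2) finite_subset by blast
          show "disjoint_family_on B J'" using that(2) prems(3) disjoint_family_on_mono by blast
          show "V \<inter> B j = {}" if "j \<in> J'" for j using that \<open>J' \<subseteq> J\<close> prems(4) by blast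
        qed (use that in blast)+
        then have "client_forces b (?goal J) (U - A) (insert x C)"
          by (rule client_forces_mono) (use that(2) in blast)
        then show ?thesis using that(1) by blast
      qed
      show "\<exists>x\<in>A. client_forces b (?goal J) (U - A) (insert x C)"
      proof (cases "A \<inter> V = {}")
        case False
        obtain x where x: "x \<in> A \<inter> V" "client_forces b W (U \<inter> V - A \<inter> V) (insert x (C \<inter> V))"
          using client_forces_step[OF prems(5), of "A \<inter> V"] A False cardA[of V] by auto
        have eqs: "(U - A) \<inter> V = U \<inter> V - A \<inter> V" "insert x C \<inter> V = insert x (C \<inter> V)" using x by auto
        define L where "L = {j \<in> J. A \<inter> B j \<noteq> {}}"
        have L: "L \<subseteq> J" "finite L" using prems(2) by (auto simp: L_def)
        \<comment> \<open>The answer \<open>x\<close> lies in \<open>V\<close>, off all boards, so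
          each damaged board contains one of the other at most \<open>b\<close> offered vertices.
          Counting with \<open>x\<close> would give \<open>b + 1\<close>, more than the loss of one
          vertex of \<open>V\<close> pays for.\<close>
        have "card L \<le> card (A - {x})"
        proof (rule conjunct2[OF card_hit_le])
          show "disjoint_family_on B L" using prems(3) L(1) disjoint_family_on_mono by blast
          show "(A - {x}) \<inter> B j \<noteq> {}" if "j \<in> L" for j
            using that prems(4)[of j] x(1) by (auto simp: L_def)
        qed (use A in auto)
        then have cL: "card L \<le> b" using A x by auto
        have "(\<Sum>j\<in>J. ?w U j) = (\<Sum>j\<in>J - L. ?w U j) + (\<Sum>j\<in>L. ?w U j)"
          using L prems(2) by (simp add: sum.subset_diff)
        also have "(\<Sum>j\<in>L. ?w U j) \<le> real (card L)"
          using sum_mono[of L "?w U" "\<lambda>_. 1"] w01 by simp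
        also have "\<dots> \<le> real b" using cL by simp
        finally have s: "(\<Sum>j\<in>J. ?w U j) \<le> (\<Sum>j\<in>J - L. ?w U j) + real b" by simp
        have "card ((U - A) \<inter> V) < card (U \<inter> V)"
          using x A prems(1) by (intro psubset_card_mono) auto
        then have "real b * (real (card ((U - A) \<inter> V)) + 1) \<le> real b * real (card (U \<inter> V))"
          by (intro mult_left_mono) auto
        then have s2: "real b * real (card ((U - A) \<inter> V)) + real b \<le> real b * real (card (U \<inter> V))"
          by (simp add: algebra_simps)
        have same: "(U - A) \<inter> B j = U \<inter> B j" "insert x C \<inter> B j = C \<inter> B j" if "j \<in> J - L" for j
          using that x(1) prems(4)[of j] unfolding L_def by blast+
        show ?thesis
        proof (rule concl[of x "J - L"])
          have "(\<Sum>j\<in>J - L. ?w (U - A) j) = (\<Sum>j\<in>J - L. ?w U j)"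
            by (intro sum.cong) (simp_all add: same)
          then show "real b * real (card ((U - A) \<inter> V)) < (\<Sum>j\<in>J - L. ?w (U - A) j)"
            using s s2 prems(7) by linarith
        qed (use x eqs same prems(6) in simp_all)
      next
        case True
        define L where "L = {j \<in> J. A \<inter> B j \<noteq> {}}"
        have L: "L \<subseteq> J" "finite L" using prems(2) by (auto simp: L_def)
        have cL: "card L \<le> b + 1"
        proof -
          have "disjoint_family_on B L" using prems(3) L(1) disjoint_family_on_mono by blast
          then have "card L \<le> card A"
            using card_hit_le[of A B L] A(3) unfolding L_def by blast
          then show ?thesis using A(4) by linarith
        qed
        have V: "(U - A) \<inter> V = U \<inter> V" "\<And>x. x \<in> A \<Longrightarrow> insert x C \<inter> V = C \<inter> V" using True by auto
        have same: "(U - A) \<inter> B j = U \<inter> B j" "\<And>x. x \<in> A \<Longrightarrow> insert x C \<inter> B j = C \<inter> B j"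
          if "j \<in> J - L" for j
          using that unfolding L_def by blast+
        have sumsame: "(\<Sum>j\<in>J - L. ?w (U - A) j) = (\<Sum>j\<in>J - L. ?w U j)"
          by (intro sum.cong) (simp_all add: same)
        show ?thesis
        proof (cases "L = {}")
          case True
          obtain x where "x \<in> A" using A by auto
          then show ?thesis
            using True V same prems(5-7) sumsame by (intro concl[of x J]) simp_all
        next
          case False
          obtain k where k: "k \<in> L" "\<And>j. j \<in> L \<Longrightarrow> ?w U j \<le> ?w U k"
          proof -
            have "Max (?w U ` L) \<in> ?w U ` L" using L(2) False by (intro Max_in) auto
            then obtain k where "k \<in> L" "?w U k = Max (?w U ` L)" by auto
            then show thesis using L(2) by (intro that[of k]) simp_all
          qed
          have kJ: "k \<in> J" using k L by auto
          have "A \<inter> B k \<subseteq> U \<inter> B k" "A \<inter> B k \<noteq> {}" "finite (A \<inter> B k)"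
            using A k(1) by (auto simp: L_def)
          then obtain x where x: "x \<in> A \<inter> B k"
              "client_forces b (W' k) (U \<inter> B k - A \<inter> B k) (insert x (C \<inter> B k))"
            using client_forces_step[OF prems(6)[OF kJ], of "A \<inter> B k"] cardA[of "B k"] by blast
          have eqs: "(U - A) \<inter> B k = U \<inter> B k - A \<inter> B k" "insert x C \<inter> B k = insert x (C \<inter> B k)"
            using x by auto
          have "card ((U - A) \<inter> B k) < card (U \<inter> B k)"
            using x A prems(1) by (intro psubset_card_mono) auto
          then have "(1 / (real b + 1)) ^ (card (U \<inter> B k) - 1) \<le> ?w (U - A) k"
            by (intro power_decreasing) auto
          moreover have "?w U k = (1 / (real b + 1)) * (1 / (real b + 1)) ^ (card (U \<inter> B k) - 1)"
            using \<open>card ((U - A) \<inter> B k) < card (U \<inter> B k)\<close>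
            by (subst power_Suc[symmetric]) simp
          then have "(real b + 1) * ?w U k = (1 / (real b + 1)) ^ (card (U \<inter> B k) - 1)"
            by simp
          ultimately have gain: "(real b + 1) * ?w U k \<le> ?w (U - A) k"
            by linarith
          have "(\<Sum>j\<in>J. ?w U j) = (\<Sum>j\<in>J - L. ?w U j) + (\<Sum>j\<in>L. ?w U j)"
            using L prems(2) by (simp add: sum.subset_diff)
          also have "(\<Sum>j\<in>L. ?w U j) \<le> real (card L) * ?w U k"
            using sum_mono[of L "?w U" "\<lambda>_. ?w U k"] k(2) by simp
          also have "\<dots> \<le> (real b + 1) * ?w U k"
            using cL w01 by (intro mult_right_mono) auto
          also note gain
          finally have s: "(\<Sum>j\<in>J. ?w U j) \<le> (\<Sum>j\<in>J - L. ?w U j) + ?w (U - A) k" by simp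
          show ?thesis
          proof (rule concl[of x "insert k (J - L)"])
            have "(\<Sum>j\<in>insert k (J - L). ?w (U - A) j) = (\<Sum>j\<in>J - L. ?w U j) + ?w (U - A) k"
              using prems(2) k(1) sumsame by simp
            then show "real b * real (card ((U - A) \<inter> V)) < (\<Sum>j\<in>insert k (J - L). ?w (U - A) j)"
              using s prems(7) V by simp
            show "client_forces b (W' j) ((U - A) \<inter> B j) (insert x C \<inter> B j)"
              if "j \<in> insert k (J - L)" for j
            proof (cases "j = k")
              case True
              then show ?thesis using x(2) eqs by simp
            next
              case False
              then show ?thesis using that same[of j] x(1) prems(6)[of j] by simp
            qed
          qed (use x V prems(5) kJ in auto)
        qed
      qed
    qed
  qed
qed

text \<open>A board with at most \<open>s\<close> vertices starts with weight at least
  \<open>(1 / (b + 1)) ^ s\<close>, so this many boards together outweigh the cost of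
  \<open>b\<close> for each vertex of \<open>V\<close>.\<close>

lemma client_forces_both:
  assumes "finite U" "finite J" "disjoint_family_on B J" "\<And>j. j \<in> J \<Longrightarrow> V \<inter> B j = {}"
    and "V \<subseteq> U" "\<And>j. j \<in> J \<Longrightarrow> B j \<subseteq> U" "\<And>j. j \<in> J \<Longrightarrow> card (B j) \<le> s"
    and "client_forces b W V {}" "\<And>j. j \<in> J \<Longrightarrow> client_forces b (W' j) (B j) {}"
    and "b * card V * (b + 1) ^ s < card J"
  shows "client_forces b (\<lambda>S. W (S \<inter> V) \<and> (\<exists>j\<in>J. W' j (S \<inter> B j))) U {}"
proof (rule client_forces_both_pos[where V = V and B = B and J = J and W = W and W' = W'])
  have eq: "U \<inter> V = V" "\<And>j. j \<in> J \<Longrightarrow> U \<inter> B j = B j" using assms(5,6) by auto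
  show "client_forces b W (U \<inter> V) ({} \<inter> V)" using assms(8) eq by simp
  show "client_forces b (W' j) (U \<inter> B j) ({} \<inter> B j)" if "j \<in> J" for j
    using assms(9) eq that by simp
  have "real (b * card V * (b + 1) ^ s) < real (card J)" using assms(10) by (simp only: of_nat_less_iff)
  then have "real b * real (card V) * (real b + 1) ^ s < real (card J)" by (simp add: add.commute)
  then have "real b * real (card V) < real (card J) * (1 / (real b + 1)) ^ s"
    by (simp add: power_divide pos_less_divide_eq)
  also have "\<dots> \<le> (\<Sum>j\<in>J. (1 / (real b + 1)) ^ card (B j))"
    by (subst sum_constant[symmetric], intro sum_mono power_decreasing assms(7)) auto
  finally show "real b * real (card (U \<inter> V)) < (\<Sum>j\<in>J. (1 / (real b + 1)) ^ card (U \<inter> B j))"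
    using eq by simp
qed (use assms(1-4) in simp_all)

text \<open>The classes are added one at a time: all that is secured so far becomes the main board
  against which the next class is played. \<open>N\<close> stands before the quantifiers over boards
  because the graphs are built only once \<open>N\<close> is known.\<close>

lemma client_forces_many:
  fixes I :: "'i set"
  assumes "finite I"
  shows "\<exists>N::nat. \<forall>(U :: 'v set) V W B W'. finite U \<and> V \<subseteq> U \<and> card V \<le> r \<and> client_forces b W V {} \<and>
      disjoint_family_on B (I \<times> {..<N}) \<and>
      (\<forall>k \<in> I \<times> {..<N}. B k \<subseteq> U \<and> V \<inter> B k = {} \<and> card (B k) \<le> s \<and> client_forces b (W' k) (B k) {}) \<longrightarrow>
    client_forces b (\<lambda>S. W (S \<inter> V) \<and> (\<forall>i\<in>I. \<exists>t<N. W' (i, t) (S \<inter> B (i, t)))) U {}"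
  (is "\<exists>N. ?P I N")
  using assms
proof (induction I)
  case empty
  have "client_forces b (\<lambda>S. W (S \<inter> V)) U {}"
    if "finite U" "V \<subseteq> U" "client_forces b W V {}" for U V :: "'v set" and W
    using client_forces_restrict[of U b W V "{}"] that by (simp add: Int_absorb1)
  then show ?case by simp
next
  case (insert i I)
  obtain N where N: "?P I N" using insert.IH by (rule exE)
  \<comment> \<open>The summand \<open>N\<close> keeps the earlier boards within the first
    \<open>M\<close>; the product is the requirement of \<open>client_forces_both\<close> for a main
    board of at most \<open>r + card I * N * s\<close> vertices; the 1 makes it strict.\<close>
  define M where "M = N + b * (r + card I * N * s) * (b + 1) ^ s + 1"
  show ?case
  proof (intro exI[of _ M] allI impI, elim conjE)
    fix U V :: "'v set" and W B W'
    assume U: "finite U" "V \<subseteq> U" "card V \<le> r" "client_forces b W V {}"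
      and dis: "disjoint_family_on B (insert i I \<times> {..<M})"
      and B: "\<forall>k\<in>insert i I \<times> {..<M}. B k \<subseteq> U \<and> V \<inter> B k = {} \<and> card (B k) \<le> s
        \<and> client_forces b (W' k) (B k) {}"
    define V' where "V' = V \<union> (\<Union>k\<in>I \<times> {..<N}. B k)"
    have NM: "N \<le> M" by (simp add: M_def)
    have sub: "I \<times> {..<N} \<subseteq> insert i I \<times> {..<M}" using NM by auto
    have V'U: "V' \<subseteq> U" using U(2) B sub unfolding V'_def by blast
    have fV': "finite V'" using V'U U finite_subset by blast
    have "card V' \<le> card V + card (\<Union>k\<in>I \<times> {..<N}. B k)"
      unfolding V'_def by (rule card_Un_le)
    also have "card (\<Union>k\<in>I \<times> {..<N}. B k) \<le> (\<Sum>k\<in>I \<times> {..<N}. card (B k))"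
      by (rule card_UN_le) (use insert in auto)
    also have "\<dots> \<le> (\<Sum>k\<in>I \<times> {..<N}. s)"
      by (rule sum_mono) (use B sub in blast)
    also have "\<dots> = card I * N * s" by (simp add: card_cartesian_product)
    finally have cV': "card V' \<le> r + card I * N * s" using U(3) by linarith
    have win: "client_forces b (\<lambda>S. W (S \<inter> V) \<and> (\<forall>i\<in>I. \<exists>t<N. W' (i, t) (S \<inter> B (i, t)))) V' {}"
    proof (rule N[rule_format, of V' V W B W'], intro conjI ballI)
      show "disjoint_family_on B (I \<times> {..<N})" using dis sub disjoint_family_on_mono by blast
      show "V \<subseteq> V'" by (simp add: V'_def)
      fix k assume k: "k \<in> I \<times> {..<N}"
      then show "B k \<subseteq> V'" unfolding V'_def by blast
      have "k \<in> insert i I \<times> {..<M}" using sub k by blast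
      then show "V \<inter> B k = {}" "card (B k) \<le> s" "client_forces b (W' k) (B k) {}"
        using B by blast+
    qed (use U fV' in simp_all)
    have "client_forces b (\<lambda>S. (W (S \<inter> V' \<inter> V) \<and> (\<forall>i\<in>I. \<exists>t<N. W' (i, t) (S \<inter> V' \<inter> B (i, t)))) \<and>
        (\<exists>t\<in>{..<M}. W' (i, t) (S \<inter> B (i, t)))) U {}"
    proof (rule client_forces_both[OF _ _ _ _ _ _ _ win,
          where s = s and J = "{..<M}" and B = "\<lambda>t. B (i, t)" and W' = "\<lambda>t. W' (i, t)"])
      show "disjoint_family_on (\<lambda>t. B (i, t)) {..<M}"
        using dis unfolding disjoint_family_on_def by simp
      show "V' \<inter> B (i, t) = {}" if "t \<in> {..<M}" for t
      proof -
        have it: "(i, t) \<in> insert i I \<times> {..<M}" using that by simp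
        have "B k \<inter> B (i, t) = {}" if "k \<in> I \<times> {..<N}" for k
        proof (rule disjoint_family_onD[OF dis _ it])
          show "k \<in> insert i I \<times> {..<M}" using that sub by blast
          show "k \<noteq> (i, t)" using that insert(2) by auto
        qed
        moreover have "V \<inter> B (i, t) = {}" using B it by blast
        ultimately show ?thesis unfolding V'_def by blast
      qed
      have "b * card V' * (b + 1) ^ s \<le> b * (r + card I * N * s) * (b + 1) ^ s"
        by (intro mult_right_mono mult_left_mono cV') simp_all
      then show "b * card V' * (b + 1) ^ s < card {..<M}"
        unfolding M_def card_lessThan by linarith
    qed (use U B V'U in simp_all)
    then show "client_forces b (\<lambda>S. W (S \<inter> V) \<and> (\<forall>i\<in>insert i I. \<exists>t<M. W' (i, t) (S \<inter> B (i, t)))) U {}"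
    proof (rule client_forces_mono)
      fix S assume S: "(W (S \<inter> V' \<inter> V) \<and> (\<forall>i\<in>I. \<exists>t<N. W' (i, t) (S \<inter> V' \<inter> B (i, t)))) \<and>
        (\<exists>t\<in>{..<M}. W' (i, t) (S \<inter> B (i, t)))"
      have "S \<inter> V' \<inter> V = S \<inter> V" by (auto simp: V'_def)
      moreover have "S \<inter> V' \<inter> B (j, t) = S \<inter> B (j, t)" if "j \<in> I" "t < N" for j t
        using that by (auto simp: V'_def)
      ultimately show "W (S \<inter> V) \<and> (\<forall>i\<in>insert i I. \<exists>t<M. W' (i, t) (S \<inter> B (i, t)))"
        using S NM less_le_trans by (metis insert_iff lessThan_iff)
    qed
  qed
qed

text \<open>Waiter plays the boards one after the other.\<close>

lemma not_client_forces_Union: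
  assumes "finite U" "U \<subseteq> (\<Union>j\<in>J. B j)" "disjoint_family_on B J"
    and "\<And>j. j \<in> J \<Longrightarrow> \<not> client_forces b (W j) (U \<inter> B j) (C \<inter> B j)"
  shows "\<not> client_forces b (\<lambda>S. \<exists>j\<in>J. W j (S \<inter> B j)) U C"
  using assms
proof (induction "card U" arbitrary: U C rule: less_induct)
  case less
  note prems = less.prems
  show ?case
  proof (cases "U = {}")
    case True
    then show ?thesis using prems by (simp add: client_forces_empty_iff)
  next
    case False
    then obtain j where j: "j \<in> J" "U \<inter> B j \<noteq> {}" using prems(2) by blast
    \<comment> \<open>Any board with a free vertex will do. As Client cannot force it, the rule
      \<open>offer\<close> must fail there, which yields an offer inside the board with all answers
      still lost; the other boards do not change.\<close>
    have "\<exists>A. A \<subseteq> U \<inter> B j \<and> A \<noteq> {} \<and> finite A \<and> card A \<le> b + 1 \<and>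
        (\<forall>x\<in>A. \<not> client_forces b (W j) (U \<inter> B j - A) (insert x (C \<inter> B j)))"
      using prems(4)[OF j(1)] client_forces.offer[OF j(2), of b "W j" "C \<inter> B j"] by blast
    then obtain A where A: "A \<subseteq> U \<inter> B j" "A \<noteq> {}" "finite A" "card A \<le> b + 1"
      and lose: "\<And>x. x \<in> A \<Longrightarrow> \<not> client_forces b (W j) (U \<inter> B j - A) (insert x (C \<inter> B j))" by blast
    have "\<not> client_forces b (\<lambda>S. \<exists>j\<in>J. W j (S \<inter> B j)) (U - A) (insert x C)" if x: "x \<in> A" for x
    proof (rule less.hyps)
      show "card (U - A) < card U"
        using A prems(1) by (intro psubset_card_mono) auto
      show "\<not> client_forces b (W i) ((U - A) \<inter> B i) (insert x C \<inter> B i)" if i: "i \<in> J" for i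
      proof (cases "i = j")
        case True
        have "(U - A) \<inter> B j = U \<inter> B j - A" "insert x C \<inter> B j = insert x (C \<inter> B j)" using x A by auto
        then show ?thesis using lose[OF x] True by simp
      next
        case False
        then have "B i \<inter> B j = {}" using prems(3) i j unfolding disjoint_family_on_def by auto
        then have "(U - A) \<inter> B i = U \<inter> B i" "insert x C \<inter> B i = C \<inter> B i" using x A by auto
        then show ?thesis using prems(4)[OF i] by simp
      qed
    qed (use prems in auto)
    moreover have "A \<subseteq> U" using A by auto
    ultimately show ?thesis using A by (meson client_forces_step)
  qed
qed

subsection \<open>Trees grown leaf by leaf\<close>

text \<open>An inductive form of finite trees, shown equivalent to \<open>is_tree\<close>. It gives
  induction by leaves and exact edge counts, which the definition through cycles and reachability
  does not provide directly.\<close>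

inductive leaf_grown :: "'v set \<Rightarrow> 'v set set \<Rightarrow> bool" where
  single: "leaf_grown {x} {}"
| leaf: "leaf_grown V E \<Longrightarrow> x \<in> V \<Longrightarrow> y \<notin> V \<Longrightarrow> leaf_grown (insert y V) (insert {x, y} E)"

lemma leaf_grown_wf:
  assumes "leaf_grown V E"
  shows "finite V \<and> V \<noteq> {} \<and> finite E \<and> (\<forall>a\<in>E. a \<subseteq> V \<and> card a = 2)"
  using assms by induction (auto simp: card_insert_if)

lemma leaf_grown_card:
  assumes "leaf_grown V E"
  shows "card V = card E + 1"
  using assms
proof induction
  case (leaf V E x y)
  then have "{x, y} \<notin> E" using leaf_grown_wf by fastforce
  then show ?case using leaf leaf_grown_wf[OF leaf(1)] by simp
qed simp

text \<open>Removing the last leaf \<open>y\<close> from \<open>I\<close> loses at most one edge.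
  For empty \<open>I\<close> the truncated subtraction gives 0, which is right since edges have two
  elements. In the second moment this bounds the number of edges that two copies share.\<close>

lemma leaf_grown_edges_inside:
  assumes "leaf_grown V E" "I \<subseteq> V"
  shows "card {a \<in> E. a \<subseteq> I} \<le> card I - 1"
  using assms
proof (induction arbitrary: I)
  case (leaf V E x y)
  note wf = leaf_grown_wf[OF leaf(1)]
  have fin: "finite I" using leaf.prems wf finite_subset by blast
  have eq: "{a \<in> E. a \<subseteq> I} = {a \<in> E. a \<subseteq> I - {y}}" using wf leaf(3) by blast
  have IH: "card {a \<in> E. a \<subseteq> I - {y}} \<le> card (I - {y}) - 1"
    using leaf.prems by (intro leaf.IH) auto
  show ?case
  proof (cases "{x, y} \<subseteq> I")
    case True
    have xy: "x \<in> I - {y}" using True leaf(2,3) by auto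
    have "{a \<in> insert {x, y} E. a \<subseteq> I} = insert {x, y} {a \<in> E. a \<subseteq> I}" using True by auto
    then have "card {a \<in> insert {x, y} E. a \<subseteq> I} \<le> Suc (card {a \<in> E. a \<subseteq> I})"
      using wf by (simp add: card_insert_if)
    also have "\<dots> \<le> Suc (card (I - {y}) - 1)" using IH eq by simp
    also have "\<dots> = card (I - {y})" using xy fin by (metis One_nat_def Suc_pred card_gt_0_iff empty_iff finite_Diff)
    also have "\<dots> = card I - 1" using True fin by simp
    finally show ?thesis .
  next
    case False
    then have "{a \<in> insert {x, y} E. a \<subseteq> I} = {a \<in> E. a \<subseteq> I}" by auto
    moreover have "card (I - {y}) \<le> card I" using fin by (simp add: card_mono)
    ultimately show ?thesis using IH eq by simp
  qed
qed auto

lemma leaf_grown_connected: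
  assumes "leaf_grown V E" "u \<in> V" "w \<in> V"
  shows "(adj (V, E))\<^sup>*\<^sup>* u w"
  using assms
proof (induction arbitrary: u w)
  case (leaf V E x y)
  have old: "(adj (insert y V, insert {x, y} E))\<^sup>*\<^sup>* u w" if "u \<in> V" "w \<in> V" for u w
    by (rule rtranclp_mono[THEN predicate2D, OF _ leaf.IH[OF that]])
      (auto simp: adj_def edges_def)
  have xy: "adj (insert y V, insert {x, y} E) x y" "adj (insert y V, insert {x, y} E) y x"
    by (auto simp: adj_def edges_def insert_commute)
  show ?case
  proof (cases "u = y"; cases "w = y")
    assume "u = y" "w \<noteq> y"
    then show ?thesis using old[of x w] leaf.prems leaf(2) xy
      by (metis converse_rtranclp_into_rtranclp insertE)
  next
    assume "u \<noteq> y" "w = y"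
    then show ?thesis using old[of u x] leaf.prems leaf(2) xy
      by (metis rtranclp.rtrancl_into_rtrancl insertE)
  next
    assume "u \<noteq> y" "w \<noteq> y"
    then show ?thesis using old[of u w] leaf.prems by auto
  qed auto
qed auto

text \<open>On a cycle through the new leaf \<open>y\<close>, both cyclic neighbours of
  \<open>y\<close> would be \<open>x\<close>; as the length is at least 3 they occupy different
  positions, against distinctness. A cycle avoiding \<open>y\<close> lives in the smaller
  tree.\<close>

lemma leaf_grown_acyclic:
  assumes "leaf_grown V E"
  shows "\<not> has_cycle (V, E)"
  using assms
proof induction
  case (single x)
  then show ?case by (fastforce simp: has_cycle_def adj_def edges_def)
next
  case (leaf V E x y)
  note wf = leaf_grown_wf[OF leaf(1)]
  show ?case
  proof
    assume "has_cycle (insert y V, insert {x, y} E)"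
    then obtain xs where xs: "length xs \<ge> 3" "distinct xs" "set xs \<subseteq> insert y V"
      and a: "\<And>i. i < length xs \<Longrightarrow> {xs ! i, xs ! ((i + 1) mod length xs)} \<in> insert {x, y} E"
      by (auto simp: has_cycle_def adj_def edges_def verts_def)
    let ?l = "length xs"
    show False
    proof (cases "y \<in> set xs")
      case True
      then obtain i where i: "i < ?l" "xs ! i = y" by (auto simp: in_set_conv_nth)
      have nb: "z = x" if "{y, z} \<in> insert {x, y} E" for z
        using that wf leaf(3) by (auto simp: doubleton_eq_iff)
      define k where "k = (if i = 0 then ?l - 1 else i - 1)"
      define j where "j = (if i = ?l - 1 then 0 else i + 1)"
      have k: "k < ?l" "(k + 1) mod ?l = i" and j: "j < ?l" "(i + 1) mod ?l = j" and kj: "k \<noteq> j"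
      proof -
        obtain l where "?l = Suc l" using xs(1) by (cases ?l) auto
        then show "k < ?l" "(k + 1) mod ?l = i" "j < ?l" "(i + 1) mod ?l = j" "k \<noteq> j"
          using xs(1) i(1) by (auto simp: k_def j_def)
      qed
      have "xs ! j = x" using a[OF i(1)] nb i j by simp
      moreover have "xs ! k = x" using a[OF k(1)] nb i k by (simp add: insert_commute)
      ultimately show False using kj k j xs(2) nth_eq_iff_index_eq by metis
    next
      case False
      have ne: "xs ! i \<noteq> y" if "i < ?l" for i using False that by force
      have "{xs ! i, xs ! ((i + 1) mod ?l)} \<in> E" if "i < ?l" for i
      proof -
        have "(i + 1) mod ?l < ?l" using that by (intro mod_less_divisor) auto
        then have "{xs ! i, xs ! ((i + 1) mod ?l)} \<noteq> {x, y}"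
          using ne that by (auto simp: doubleton_eq_iff)
        then show ?thesis using a[OF that] by auto
      qed
      then have "has_cycle (V, E)"
        using xs False unfolding has_cycle_def adj_def edges_def verts_def
        by (intro exI[of _ xs]) auto
      then show False using leaf.IH by simp
    qed
  qed
qed

lemma leaf_grown_is_tree:
  assumes "leaf_grown V E"
  shows "is_tree (V, E)"
  using leaf_grown_wf[OF assms] leaf_grown_acyclic[OF assms] leaf_grown_connected[OF assms]
  by (auto simp: is_tree_def is_forest_def wf_graph_def connected_graph_def verts_def edges_def)

lemma leaf_grown_add_leaves:
  assumes "leaf_grown V E" "finite L" "L \<inter> V = {}" "\<And>l. l \<in> L \<Longrightarrow> par l \<in> V"
  shows "leaf_grown (V \<union> L) (E \<union> (\<lambda>l. {par l, l}) ` L)"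
  using assms(2-4)
proof (induction L)
  case empty
  then show ?case using assms(1) by simp
next
  case (insert l L)
  then have "leaf_grown (insert l (V \<union> L)) (insert {par l, l} (E \<union> (\<lambda>l. {par l, l}) ` L))"
    by (intro leaf_grown.leaf) auto
  then show ?case by simp
qed

lemma rtranclp_leaves_set:
  assumes "r\<^sup>*\<^sup>* u w" "u \<in> S" "w \<notin> S"
  obtains x y where "r x y" "x \<in> S" "y \<notin> S"
  using assms
  by (induction rule: rtranclp_induct) auto

text \<open>A path from \<open>S\<close> to a vertex outside crosses the boundary of
  \<open>S\<close>, and the crossing edge supplies the next leaf. The exact size \<open>k\<close>
  serves twice: for spanning trees, and for finding a tree on exactly \<open>v\<close> vertices in a
  large component.\<close>

lemma connected_graph_leaf_grown_sub:
  assumes "wf_graph G" "connected_graph G" "1 \<le> k" "k \<le> card (verts G)"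
  shows "\<exists>S D. S \<subseteq> verts G \<and> D \<subseteq> edges G \<and> card S = k \<and> leaf_grown S D"
  using assms(3,4)
proof (induction k rule: nat_induct_at_least)
  case base
  then obtain x where "x \<in> verts G" by fastforce
  then show ?case by (intro exI[of _ "{x}"] exI[of _ "{}"]) (auto intro: leaf_grown.single)
next
  case (Suc k)
  then obtain S D where S: "S \<subseteq> verts G" "D \<subseteq> edges G" "card S = k" "leaf_grown S D" by auto
  have "S \<noteq> verts G" using S(3) Suc by auto
  then obtain w where w: "w \<in> verts G" "w \<notin> S" using S(1) by auto
  obtain u where u: "u \<in> S" using leaf_grown_wf[OF S(4)] by auto
  have "(adj G)\<^sup>*\<^sup>* u w" using assms(2) u w S(1) by (auto simp: connected_graph_def)
  then obtain x y where xy: "adj G x y" "x \<in> S" "y \<notin> S"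
    using u w(2) by (rule rtranclp_leaves_set)
  have "y \<in> verts G" using xy(1) assms(1) by (auto simp: adj_def wf_graph_def)
  moreover have "card (insert y S) = Suc k" using S leaf_grown_wf[OF S(4)] xy by simp
  ultimately show ?case using S xy leaf_grown.leaf[OF S(4) xy(2,3)]
    by (intro exI[of _ "insert y S"] exI[of _ "insert {x, y} D"]) (auto simp: adj_def)
qed

lemma connected_graph_spanning:
  assumes "wf_graph G" "connected_graph G" "verts G \<noteq> {}"
  obtains D where "D \<subseteq> edges G" "leaf_grown (verts G) D"
proof -
  have fin: "finite (verts G)" using assms(1) by (simp add: wf_graph_def)
  then obtain S D where "S \<subseteq> verts G" "D \<subseteq> edges G" "card S = card (verts G)" "leaf_grown S D"
    using connected_graph_leaf_grown_sub[OF assms(1,2), of "card (verts G)"] assms(3)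
    by (auto simp: Suc_le_eq card_gt_0_iff)
  moreover from this have "S = verts G" using fin card_subset_eq by blast
  ultimately show ?thesis using that by blast
qed

section \<open>Simple paths, and every tree as a tree grown leaf by leaf\<close>

lemma rtranclp_simple_path:
  assumes "r\<^sup>*\<^sup>* u w"
  obtains xs where "xs \<noteq> []" "hd xs = u" "last xs = w" "distinct xs"
    "\<And>i. Suc i < length xs \<Longrightarrow> r (xs ! i) (xs ! Suc i)"
proof -
  have "\<exists>xs. xs \<noteq> [] \<and> hd xs = u \<and> last xs = w \<and> distinct xs \<and>
      (\<forall>i. Suc i < length xs \<longrightarrow> r (xs ! i) (xs ! Suc i))"
    using assms
  proof (induction rule: rtranclp_induct)
    case base
    then show ?case by (intro exI[of _ "[u]"]) auto
  next
    case (step y z)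
    then obtain xs where xs: "xs \<noteq> []" "hd xs = u" "last xs = y" "distinct xs"
      "\<And>i. Suc i < length xs \<Longrightarrow> r (xs ! i) (xs ! Suc i)" by blast
    show ?case
    proof (cases "z \<in> set xs")
      case True
      then obtain i where i: "i < length xs" "xs ! i = z" by (auto simp: in_set_conv_nth)
      have "last (take (Suc i) xs) = z" using i by (simp add: take_Suc_conv_app_nth)
      then show ?thesis using xs i by (intro exI[of _ "take (Suc i) xs"]) auto
    next
      case False
      have "r ((xs @ [z]) ! i) ((xs @ [z]) ! Suc i)" if "Suc i < length (xs @ [z])" for i
      proof (cases "Suc i < length xs")
        case True
        then show ?thesis using xs(5)[OF True] by (simp add: nth_append)
      next
        case False
        then have "i = length xs - 1" using that by simp
        then show ?thesis using xs(1,3) step(2) by (simp add: nth_append last_conv_nth)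
      qed
      then show ?thesis using xs False by (intro exI[of _ "xs @ [z]"]) auto
    qed
  qed
  then show ?thesis using that by blast
qed

text \<open>A spanning tree \<open>D\<close> exists, and an edge outside \<open>D\<close> would
  close a cycle with the simple path in \<open>D\<close> between its ends. Hence \<open>D\<close> is
  the whole edge set.\<close>

lemma is_tree_leaf_grown:
  assumes "is_tree G"
  shows "leaf_grown (verts G) (edges G)"
proof -
  have wf: "wf_graph G" and nc: "\<not> has_cycle G" and con: "connected_graph G" "verts G \<noteq> {}"
    using assms by (auto simp: is_tree_def is_forest_def)
  obtain D where D: "D \<subseteq> edges G" "leaf_grown (verts G) D"
    using connected_graph_spanning[OF wf con] .
  have "edges G \<subseteq> D"
  proof (rule ccontr)
    assume "\<not> edges G \<subseteq> D"
    then obtain a where a: "a \<in> edges G" "a \<notin> D" by auto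
    then obtain x y where xy: "a = {x, y}" "x \<noteq> y"
      using wf by (metis wf_graph_def card_2_iff)
    have xyV: "x \<in> verts G" "y \<in> verts G" using wf a xy by (auto simp: wf_graph_def)
    obtain xs where xs: "xs \<noteq> []" "hd xs = x" "last xs = y" "distinct xs"
      "\<And>i. Suc i < length xs \<Longrightarrow> adj (verts G, D) (xs ! i) (xs ! Suc i)"
      by (rule rtranclp_simple_path[OF leaf_grown_connected[OF D(2) xyV]]) blast
    have adjD: "{xs ! i, xs ! Suc i} \<in> D" if "Suc i < length xs" for i
      using xs(5)[OF that] by (simp add: adj_def edges_def)
    have "length xs \<noteq> 0" using xs(1) by simp
    moreover have "length xs \<noteq> 1" using xs xy by (auto simp: length_Suc_conv)
    \<comment> \<open>\<open>has_cycle\<close> demands three vertices. A path on two vertices would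
      be the edge \<open>a\<close> itself, which is not in \<open>D\<close>.\<close>
    moreover have "length xs \<noteq> 2"
    proof
      assume l: "length xs = 2"
      then have "{xs ! 0, xs ! 1} \<in> D" using adjD[of 0] by simp
      moreover have "xs ! 0 = x" "xs ! 1 = y"
        using xs l by (auto simp: hd_conv_nth last_conv_nth)
      ultimately show False using a xy by simp
    qed
    ultimately have len: "3 \<le> length xs" by linarith
    have adjG: "adj G (xs ! i) (xs ! ((i + 1) mod length xs))" if "i < length xs" for i
    proof (cases "Suc i < length xs")
      case True
      then show ?thesis using adjD[OF True] D(1) by (auto simp: adj_def)
    next
      case False
      then have "Suc i = length xs" using that by simp
      then have "xs ! i = y" "xs ! ((i + 1) mod length xs) = x"
        using xs(1-3) by (auto simp: last_conv_nth hd_conv_nth simp flip: \<open>Suc i = length xs\<close>)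
      then show ?thesis using a xy by (simp add: adj_def insert_commute)
    qed
    have "set xs \<subseteq> verts G"
    proof
      fix z assume "z \<in> set xs"
      then obtain i where "i < length xs" "xs ! i = z" by (auto simp: in_set_conv_nth)
      then show "z \<in> verts G" using adjG[of i] wf by (auto simp: adj_def wf_graph_def)
    qed
    then have "has_cycle G" unfolding has_cycle_def using len xs(4) adjG by blast
    then show False using nc by simp
  qed
  then show ?thesis using D by auto
qed

lemma verts_pair [simp]: "verts (V, E) = V" and edges_pair [simp]: "edges (V, E) = E"
  by (simp_all add: verts_def edges_def)

lemma graph_eta: "(verts G, edges G) = G"
  by (simp add: verts_def edges_def)

subsection \<open>Trees on which Client wins\<close>

lemma client_forces_singleton: "client_forces b (\<lambda>S. x \<in> S) {x} {}"
proof (rule client_forces.offer)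
  fix A assume "A \<subseteq> {x}" "A \<noteq> {}"
  then have "A = {x}" by auto
  then show "\<exists>y\<in>A. client_forces b (\<lambda>S. x \<in> S) ({x} - A) {y}"
    by (simp add: client_forces_empty_iff)
qed simp

text \<open>If Client wins for \<open>H\<close> on \<open>T\<close>, hang many leaves on every vertex of \<open>T\<close>: besides winning on
  \<open>T\<close>, he can claim a leaf at each vertex of \<open>T\<close>, hence extend his copy of \<open>H\<close> by a leaf anywhere.\<close>

lemma leaf_grown_client_forces:
  fixes V :: "'v set"
  assumes "leaf_grown V E"
  shows "\<exists>(VT :: nat set) ET. leaf_grown VT ET \<and>
    client_forces b (contains_copy (V, E) (VT, ET)) VT {}"
  using assms
proof induction
  case (single x)
  have "contains_copy ({x}, {}) ({0::nat}, {}) {0}"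
    by (auto simp: contains_copy_def)
  then have "client_forces b (contains_copy ({x}, {}) ({0::nat}, {})) {0} {}"
    by (intro client_forces_mono[OF client_forces_singleton]) (simp add: subset_singleton_iff, blast)
  with leaf_grown.single show ?case by (intro exI conjI)
next
  case (leaf V E u y)
  note wf = leaf_grown_wf[OF leaf(1)]
  from leaf.IH obtain VT :: "nat set" and ET
    where T: "leaf_grown VT ET" "client_forces b (contains_copy (V, E) (VT, ET)) VT {}" by blast
  have finVT: "finite VT" using leaf_grown_wf[OF T(1)] by simp
  obtain N :: nat where N: "\<forall>(U :: nat set) V W B W'. finite U \<and> V \<subseteq> U \<and> card V \<le> card VT \<and> client_forces b W V {} \<and>
      disjoint_family_on B (VT \<times> {..<N}) \<and>
      (\<forall>k \<in> VT \<times> {..<N}. B k \<subseteq> U \<and> V \<inter> B k = {} \<and> card (B k) \<le> 1 \<and> client_forces b (W' k) (B k) {}) \<longrightarrow>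
    client_forces b (\<lambda>S. W (S \<inter> V) \<and> (\<forall>i\<in>VT. \<exists>t<N. W' (i, t) (S \<inter> B (i, t)))) U {}"
    using client_forces_many[OF finVT, where r = "card VT" and b = b and s = 1 and ?'v = nat] by (rule exE)
  \<comment> \<open>\<open>new (i, t)\<close> is the \<open>t\<close>-th leaf hung on
    \<open>i\<close>. The shift beyond \<open>Max VT\<close> makes it fresh, and the pairing
    function makes it distinct from the others and lets \<open>par\<close> recover its
    parent.\<close>
  define new where "new k = Suc (Max VT) + prod_encode k" for k
  have new_notin: "new k \<notin> VT" for k
  proof
    assume "new k \<in> VT"
    then have "new k \<le> Max VT" using finVT by simp
    then show False by (simp add: new_def)
  qed
  have new_inj: "new k = new k' \<longleftrightarrow> k = k'" for k k'
    by (simp add: new_def)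
  define L where "L = new ` (VT \<times> {..<N})"
  define par where "par l = fst (prod_decode (l - Suc (Max VT)))" for l
  have par_new: "par (new k) = fst k" for k by (simp add: par_def new_def)
  have finL: "finite L" using finVT by (simp add: L_def)
  let ?ET = "ET \<union> (\<lambda>l. {par l, l}) ` L"
  have grown: "leaf_grown (VT \<union> L) ?ET"
    by (rule leaf_grown_add_leaves[OF T(1) finL]) (auto simp: L_def new_notin par_new)
  have "client_forces b (\<lambda>S. contains_copy (V, E) (VT, ET) (S \<inter> VT) \<and>
      (\<forall>i\<in>VT. \<exists>t<N. new (i, t) \<in> S \<inter> {new (i, t)})) (VT \<union> L) {}"
  proof (rule N[rule_format, of "VT \<union> L" VT "contains_copy (V, E) (VT, ET)" "\<lambda>k. {new k}"
        "\<lambda>k S. new k \<in> S"], intro conjI ballI)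
    show "disjoint_family_on (\<lambda>k. {new k}) (VT \<times> {..<N})"
      by (auto simp: disjoint_family_on_def new_inj)
    show "finite (VT \<union> L)" using finVT finL by simp
    show "client_forces b (contains_copy (V, E) (VT, ET)) VT {}" by (rule T(2))
    show "{new k} \<subseteq> VT \<union> L" if "k \<in> VT \<times> {..<N}" for k using that by (simp add: L_def)
  qed (simp_all add: new_notin client_forces_singleton)
  then have "client_forces b (contains_copy (insert y V, insert {u, y} E) (VT \<union> L, ?ET)) (VT \<union> L) {}"
  proof (rule client_forces_mono)
    fix S assume S: "contains_copy (V, E) (VT, ET) (S \<inter> VT) \<and>
      (\<forall>i\<in>VT. \<exists>t<N. new (i, t) \<in> S \<inter> {new (i, t)})"
    then obtain f where f: "inj_on f V" "f ` V \<subseteq> S \<inter> VT" "\<And>a. a \<in> E \<Longrightarrow> f ` a \<in> ET"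
      by (auto simp: contains_copy_def)
    have fu: "f u \<in> VT" using f leaf(2) by auto
    \<comment> \<open>The copy found so far may send \<open>u\<close> to any vertex of
      \<open>VT\<close>, which is why Client has secured a leaf at each of them; the one at
      \<open>f u\<close> becomes the image of \<open>y\<close>.\<close>
    then obtain t where t: "t < N" "new (f u, t) \<in> S" using S by auto
    define g where "g = f(y := new (f u, t))"
    have gV: "g z = f z" if "z \<in> V" for z using that leaf(3) by (auto simp: g_def)
    have gy: "g y = new (f u, t)" by (simp add: g_def)
    have "inj_on g V" using f(1) inj_on_cong[of V g f] gV by simp
    moreover have "g y \<notin> g ` V" using f(2) new_notin gV gy by force
    ultimately have "inj_on g (insert y V)" using leaf(3) by simp
    moreover have "g ` insert y V \<subseteq> S" using f(2) t gV gy by auto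
    moreover have "g ` a \<in> ?ET" if "a \<in> insert {u, y} E" for a
    proof (cases "a \<in> E")
      case True
      then have "g ` a = f ` a" using wf gV by (intro image_cong) auto
      then show ?thesis using f(3)[OF True] by simp
    next
      case False
      then have "a = {u, y}" using that by simp
      then have "g ` a = {par (new (f u, t)), new (f u, t)}"
        using gV[OF leaf(2)] gy by (simp add: par_new)
      then show ?thesis using fu t by (auto simp: L_def)
    qed
    ultimately show "contains_copy (insert y V, insert {u, y} E) (VT \<union> L, ?ET) S"
      unfolding contains_copy_def verts_pair edges_pair by (intro exI[of _ g] conjI ballI)
  qed
  with grown show ?case by (intro exI conjI)
qed

lemma tree_client_wins:
  assumes "is_tree H"
  shows "\<exists>T :: nat graph. is_tree T \<and> client_wins b H T"
proof -
  obtain VT :: "nat set" and ET where "leaf_grown VT ET"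
    "client_forces b (contains_copy (verts H, edges H) (VT, ET)) VT {}"
    using leaf_grown_client_forces[OF is_tree_leaf_grown[OF assms], of b] by blast
  then show ?thesis
    by (intro exI[of _ "(VT, ET)"])
       (simp add: leaf_grown_is_tree client_wins_def cw_pos_iff_client_forces graph_eta)
qed

subsection \<open>Components\<close>

lemma adj_sym: "adj G u w \<longleftrightarrow> adj G w u"
  by (simp add: adj_def insert_commute)

lemma rtranclp_adj_sym: "(adj G)\<^sup>*\<^sup>* u w \<Longrightarrow> (adj G)\<^sup>*\<^sup>* w u"
proof (induction rule: rtranclp_induct)
  case (step y z)
  then show ?case using adj_sym[of G y z] converse_rtranclp_into_rtranclp[of "adj G" z y u] by blast
qed simp

lemma verts_induced [simp]: "verts (induced G S) = S"
  and edges_induced [simp]: "edges (induced G S) = {a \<in> edges G. a \<subseteq> S}"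
  by (simp_all add: induced_def)

lemma component_subset: "K \<in> components G \<Longrightarrow> K \<subseteq> verts G"
  by (auto simp: components_def)

lemma component_nonempty: "K \<in> components G \<Longrightarrow> K \<noteq> {}"
  by (auto simp: components_def)

lemma component_eq:
  assumes "K \<in> components G" "u \<in> K"
  shows "K = {w \<in> verts G. (adj G)\<^sup>*\<^sup>* u w}"
proof -
  obtain v where v: "K = {u\<in>verts G. (adj G)\<^sup>*\<^sup>* v u}" using assms(1) by (auto simp: components_def)
  have vu: "(adj G)\<^sup>*\<^sup>* v u" using assms(2) v by simp
  have "(adj G)\<^sup>*\<^sup>* v w \<longleftrightarrow> (adj G)\<^sup>*\<^sup>* u w" for w
    using vu rtranclp_adj_sym[OF vu] by (meson rtranclp_trans)
  then show ?thesis using v by auto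
qed

lemma components_disjoint:
  assumes "K \<in> components G" "K' \<in> components G" "K \<noteq> K'"
  shows "K \<inter> K' = {}"
proof (rule ccontr)
  assume "K \<inter> K' \<noteq> {}"
  then obtain u where u: "u \<in> K" "u \<in> K'" by auto
  have "K = K'"
    by (rule trans[OF component_eq[OF assms(1) u(1)] component_eq[OF assms(2) u(2), symmetric]])
  then show False using assms(3) by simp
qed

lemma Union_components: "\<Union> (components G) = verts G"
  by (auto simp: components_def)

lemma in_component:
  assumes "x \<in> verts G"
  obtains K where "K \<in> components G" "x \<in> K"
  using assms Union_components[of G] by blast

lemma finite_components: "wf_graph G \<Longrightarrow> finite (components G)"
  by (rule finite_subset[of _ "Pow (verts G)"]) (auto simp: wf_graph_def components_def)

lemma component_closed:
  assumes "wf_graph G" "K \<in> components G" "u \<in> K" "adj G u w"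
  shows "w \<in> K"
proof -
  have "w \<in> verts G" using assms(1,4) by (auto simp: wf_graph_def adj_def)
  then show ?thesis using component_eq[OF assms(2,3)] assms(4) by auto
qed

lemma edge_in_component:
  assumes "wf_graph G" "a \<in> edges G"
  obtains K where "K \<in> components G" "a \<subseteq> K"
proof -
  obtain x y where xy: "a = {x, y}" using assms by (metis wf_graph_def card_2_iff)
  then have "x \<in> verts G" using assms by (auto simp: wf_graph_def)
  then obtain K where K: "K \<in> components G" "x \<in> K" by (rule in_component)
  moreover have "y \<in> K" using component_closed[OF assms(1) K] assms(2) xy by (simp add: adj_def)
  ultimately show ?thesis using that xy by auto
qed

lemma wf_induced: "wf_graph G \<Longrightarrow> S \<subseteq> verts G \<Longrightarrow> wf_graph (induced G S)"
  by (auto simp: wf_graph_def intro: finite_subset)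

lemma connected_component:
  assumes "wf_graph G" "K \<in> components G"
  shows "connected_graph (induced G K)"
  unfolding connected_graph_def verts_induced
proof (intro ballI)
  fix u w assume u: "u \<in> K" and w: "w \<in> K"
  have "(adj G)\<^sup>*\<^sup>* u w" using component_eq[OF assms(2) u] w by auto
  then have "(adj (induced G K))\<^sup>*\<^sup>* u w \<and> w \<in> K"
  proof (induction rule: rtranclp_induct)
    case (step y z)
    then have "z \<in> K" using component_closed[OF assms] by blast
    moreover have "adj (induced G K) y z" using step \<open>z \<in> K\<close> by (simp add: adj_def)
    ultimately show ?case using step by auto
  qed (use u in auto)
  then show "(adj (induced G K))\<^sup>*\<^sup>* u w" by simp
qed

lemma has_cycle_induced:
  assumes "has_cycle (induced G S)" "S \<subseteq> verts G"
  shows "has_cycle G"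
proof -
  obtain xs where "length xs \<ge> 3" "distinct xs" "set xs \<subseteq> S"
      "\<forall>i<length xs. adj (induced G S) (xs ! i) (xs ! ((i + 1) mod length xs))"
    using assms(1) unfolding has_cycle_def verts_induced by blast
  then show ?thesis unfolding has_cycle_def using assms(2)
    by (intro exI[of _ xs]) (auto simp: adj_def)
qed

lemma component_of_forest_is_tree:
  assumes "is_forest H" "K \<in> components H"
  shows "is_tree (induced H K)"
proof -
  have wf: "wf_graph H" and ac: "\<not> has_cycle H" using assms(1) by (auto simp: is_forest_def)
  note sub = component_subset[OF assms(2)]
  have "\<not> has_cycle (induced H K)" using ac has_cycle_induced[OF _ sub] by blast
  then show ?thesis
    using wf_induced[OF wf sub] connected_component[OF wf assms(2)] component_nonempty[OF assms(2)]
    by (simp add: is_tree_def is_forest_def)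
qed

lemma contains_copy_induced:
  assumes "contains_copy H G S" "C \<subseteq> verts H"
  shows "contains_copy (induced H C) G S"
proof -
  obtain f where f: "inj_on f (verts H)" "f ` verts H \<subseteq> S" "\<forall>e\<in>edges H. f ` e \<in> edges G"
    using assms(1) by (auto simp: contains_copy_def)
  then show ?thesis unfolding contains_copy_def using assms(2)
    by (intro exI[of _ f]) (auto intro: inj_on_subset)
qed

lemma client_wins_induced:
  assumes "client_wins b H G" "C \<subseteq> verts H"
  shows "client_wins b (induced H C) G"
  using assms(1) unfolding client_wins_def cw_pos_iff_client_forces
  by (rule client_forces_mono) (rule contains_copy_induced[OF _ assms(2)])

text \<open>A copy of a connected graph cannot leave the component that contains one of its
  vertices. Connectedness is essential for Waiter: a copy spread over several components would not
  be stopped by defending each of them separately.\<close>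

lemma connected_copy_in_component:
  assumes "wf_graph G" "wf_graph H" "connected_graph H" "verts H \<noteq> {}"
    and "contains_copy H G S" "S \<subseteq> verts G"
  shows "\<exists>K\<in>components G. contains_copy H (induced G K) (S \<inter> K)"
proof -
  obtain f where f: "inj_on f (verts H)" "f ` verts H \<subseteq> S" "\<And>e. e\<in>edges H \<Longrightarrow> f ` e \<in> edges G"
    using assms(5) by (auto simp: contains_copy_def)
  obtain u where u: "u \<in> verts H" using assms(4) by auto
  then have "f u \<in> verts G" using f assms(6) by auto
  then obtain K where K: "K \<in> components G" "f u \<in> K" by (rule in_component)
  have inK: "f w \<in> K" if "w \<in> verts H" for w
  proof -
    have "(adj H)\<^sup>*\<^sup>* u w" using assms(3) u that by (auto simp: connected_graph_def)
    then show ?thesis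
    proof (induction rule: rtranclp_induct)
      case (step y z)
      then have "adj G (f y) (f z)" using f(3)[of "{y, z}"] by (simp add: adj_def)
      then show ?case using component_closed[OF assms(1) K(1) step.IH] by simp
    qed (use K in auto)
  qed
  have "f ` e \<subseteq> K" if "e \<in> edges H" for e
    using that inK assms(2) by (auto simp: wf_graph_def)
  then have "contains_copy H (induced G K) (S \<inter> K)"
    unfolding contains_copy_def using f inK by (intro exI[of _ f]) auto
  then show ?thesis using K by blast
qed

lemma not_client_wins_if_not_on_components:
  assumes "wf_graph G" "wf_graph H" "connected_graph H" "verts H \<noteq> {}"
    and "\<And>K. K \<in> components G \<Longrightarrow> \<not> client_wins b H (induced G K)"
  shows "\<not> client_wins b H G"
proof
  assume "client_wins b H G"
  then have "client_forces b (contains_copy H G) (verts G) {}"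
    by (simp add: client_wins_def cw_pos_iff_client_forces)
  then have "client_forces b (\<lambda>S. \<exists>K\<in>components G. contains_copy H (induced G K) (S \<inter> K)) (verts G) {}"
    by (rule client_forces_mono, intro connected_copy_in_component[OF assms(1-4)]) simp_all
  moreover have "\<not> client_forces b (\<lambda>S. \<exists>K\<in>components G. contains_copy H (induced G K) (S \<inter> K)) (verts G) {}"
  proof (rule not_client_forces_Union[where J = "components G" and B = "\<lambda>K. K"
        and W = "\<lambda>K. contains_copy H (induced G K)"])
    show "finite (verts G)" using assms(1) by (simp add: wf_graph_def)
    show "verts G \<subseteq> \<Union> ((\<lambda>K. K) ` components G)" using Union_components[of G] by simp
    show "disjoint_family_on (\<lambda>K. K) (components G)"
      using components_disjoint unfolding disjoint_family_on_def by blast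
    fix K assume K: "K \<in> components G"
    then have "verts G \<inter> K = K" using component_subset by blast
    then show "\<not> client_forces b (contains_copy H (induced G K)) (verts G \<inter> K) ({} \<inter> K)"
      using assms(5)[OF K] by (simp add: client_wins_def cw_pos_iff_client_forces)
  qed
  ultimately show False by simp
qed

text \<open>A component with at least \<open>v\<close> vertices would contain a tree on exactly
  \<open>v\<close> of them, that is, \<open>v - 1\<close> edges on \<open>v\<close> vertices. A
  smaller component has fewer edges than vertices, so it coincides with its spanning tree.\<close>

lemma sparse_components_are_small_trees:
  assumes "wf_graph G" "1 \<le> v"
    and "\<And>S. S \<subseteq> verts G \<Longrightarrow> card S = v \<Longrightarrow> card {a \<in> edges G. a \<subseteq> S} < v - 1"
    and "\<And>S. S \<subseteq> verts G \<Longrightarrow> 1 \<le> card S \<Longrightarrow> card S < v \<Longrightarrow> card {a \<in> edges G. a \<subseteq> S} < card S"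
    and "K \<in> components G"
  shows "is_tree (induced G K) \<and> card K < v"
proof -
  have KG: "K \<subseteq> verts G" "K \<noteq> {}" using component_subset[OF assms(5)] component_nonempty[OF assms(5)] by simp_all
  have finG: "finite (verts G)" using assms(1) by (simp add: wf_graph_def)
  have finK: "finite K" using KG finG finite_subset by blast
  have finE: "finite (edges G)"
    by (rule finite_subset[of _ "Pow (verts G)"]) (use finG assms(1) in \<open>auto simp: wf_graph_def\<close>)
  note con = connected_component[OF assms(1,5)] and wf = wf_induced[OF assms(1) KG(1)]
  have small: "card K < v"
  proof (rule ccontr)
    assume "\<not> card K < v"
    then obtain S D where S: "S \<subseteq> K" "D \<subseteq> {a \<in> edges G. a \<subseteq> K}" "card S = v" "leaf_grown S D"
      using connected_graph_leaf_grown_sub[OF wf con, of v] assms(2) by auto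
    have "D \<subseteq> {a \<in> edges G. a \<subseteq> S}" using S leaf_grown_wf[OF S(4)] by blast
    then have "card D \<le> card {a \<in> edges G. a \<subseteq> S}" using finE by (intro card_mono) auto
    moreover have "card D = v - 1" using leaf_grown_card[OF S(4)] S(3) by simp
    ultimately show False using assms(3)[of S] S KG by auto
  qed
  obtain D where D: "D \<subseteq> {a \<in> edges G. a \<subseteq> K}" "leaf_grown K D"
    using connected_graph_spanning[OF wf con] KG by auto
  have "1 \<le> card K" using KG finK by (simp add: Suc_le_eq card_gt_0_iff)
  then have "card {a \<in> edges G. a \<subseteq> K} \<le> card D"
    using assms(4)[OF KG(1)] small leaf_grown_card[OF D(2)] by simp
  then have "D = {a \<in> edges G. a \<subseteq> K}"
    using D(1) finE by (intro card_seteq) auto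
  then have "is_tree (induced G K)"
    using leaf_grown_is_tree[OF D(2)] by (simp add: induced_def)
  then show ?thesis using small by simp
qed

text \<open>The maps of the components glue to an injection because their ranges lie in disjoint
  boards, and they respect edges because every edge lies in one component.\<close>

lemma contains_copy_from_components:
  assumes "wf_graph H" "disjoint_family_on B (components H)"
    and "\<And>C. C \<in> components H \<Longrightarrow> contains_copy (induced H C) G (S \<inter> B C)"
  shows "contains_copy H G S"
proof -
  have "\<forall>C\<in>components H. \<exists>f. inj_on f C \<and> f ` C \<subseteq> S \<inter> B C \<and> (\<forall>e\<in>edges H. e \<subseteq> C \<longrightarrow> f ` e \<in> edges G)"
  proof
    fix C assume "C \<in> components H"
    from assms(3)[OF this] obtain f where "inj_on f C" "f ` C \<subseteq> S \<inter> B C"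
      "\<forall>e\<in>{e \<in> edges H. e \<subseteq> C}. f ` e \<in> edges G"
      unfolding contains_copy_def verts_induced edges_induced by (elim exE conjE)
    then show "\<exists>f. inj_on f C \<and> f ` C \<subseteq> S \<inter> B C \<and> (\<forall>e\<in>edges H. e \<subseteq> C \<longrightarrow> f ` e \<in> edges G)"
      by (intro exI[of _ f]) simp
  qed
  from bchoice[OF this] obtain f where f': "\<forall>C\<in>components H.
      inj_on (f C) C \<and> f C ` C \<subseteq> S \<inter> B C \<and> (\<forall>e\<in>edges H. e \<subseteq> C \<longrightarrow> f C ` e \<in> edges G)"
    by (rule exE)
  note f = bspec[OF f']
  define comp where "comp x = {w \<in> verts H. (adj H)\<^sup>*\<^sup>* x w}" for x
  have comp: "comp x = C" if "C \<in> components H" "x \<in> C" for x C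
    using component_eq[OF that] by (simp add: comp_def)
  define g where "g x = f (comp x) x" for x
  have g: "g x = f C x" if "C \<in> components H" "x \<in> C" for x C
    using comp[OF that] by (simp add: g_def)
  have "inj_on g (verts H)"
  proof (rule inj_onI)
    fix x y assume xy: "x \<in> verts H" "y \<in> verts H" "g x = g y"
    obtain C where C: "C \<in> components H" "x \<in> C" using xy(1) by (rule in_component)
    obtain D where D: "D \<in> components H" "y \<in> D" using xy(2) by (rule in_component)
    have "g x \<in> B C" "g y \<in> B D" using f[OF C(1)] f[OF D(1)] g[OF C] g[OF D] C D by auto
    then have "C = D" using assms(2) C D xy(3) unfolding disjoint_family_on_def by auto
    then show "x = y" using f[OF C(1)] C D g[OF C] g[OF D] xy(3) by (auto dest: inj_onD)
  qed
  moreover have "g ` verts H \<subseteq> S"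
  proof
    fix z assume "z \<in> g ` verts H"
    then obtain x where x: "x \<in> verts H" "z = g x" by auto
    obtain C where C: "C \<in> components H" "x \<in> C" using x(1) by (rule in_component)
    then show "z \<in> S" using f[OF C(1)] g[OF C] x by auto
  qed
  moreover have "g ` e \<in> edges G" if e: "e \<in> edges H" for e
  proof -
    obtain C where C: "C \<in> components H" "e \<subseteq> C" using edge_in_component[OF assms(1) e] .
    have "g ` e = f C ` e" using g[OF C(1)] C(2) by (intro image_cong) auto
    then show ?thesis using f[OF C(1)] e C by auto
  qed
  ultimately show ?thesis unfolding contains_copy_def by blast
qed

section \<open>Strategies on embedded copies of trees\<close>

lemma client_forces_on_copy:
  assumes "client_wins b H T" "inj_on \<phi> (verts T)" "\<And>a. a \<in> edges T \<Longrightarrow> \<phi> ` a \<in> edges G"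
  shows "client_forces b (contains_copy H G) (\<phi> ` verts T) {}"
proof -
  have "client_forces b (contains_copy H G) (\<phi> ` verts T) (\<phi> ` {})"
  proof (rule client_forces_image)
    show "client_forces b (contains_copy H T) (verts T) {}"
      using assms(1) by (simp add: client_wins_def cw_pos_iff_client_forces)
    fix S assume S: "S \<subseteq> verts T \<union> {}" "contains_copy H T S"
    then obtain f where f: "inj_on f (verts H)" "f ` verts H \<subseteq> S" "\<And>e. e\<in>edges H \<Longrightarrow> f ` e \<in> edges T"
      by (auto simp: contains_copy_def)
    have "inj_on (\<phi> \<circ> f) (verts H)"
      using f S assms(2) by (intro comp_inj_on inj_on_subset[OF assms(2)]) auto
    moreover have "(\<phi> \<circ> f) ` verts H \<subseteq> \<phi> ` S" using f(2) by auto
    moreover have "(\<phi> \<circ> f) ` e \<in> edges G" if "e \<in> edges H" for e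
      using assms(3)[OF f(3)[OF that]] by (simp add: image_comp)
    ultimately show "contains_copy H G (\<phi> ` S)" unfolding contains_copy_def by blast
  qed (use assms in auto)
  then show ?thesis by simp
qed

lemma client_wins_if_many_copies:
  fixes H :: "'a graph" and T :: "'a set \<Rightarrow> nat graph"
  assumes "wf_graph H" "\<And>C. C \<in> components H \<Longrightarrow> client_wins b (induced H C) (T C) \<and> card (verts (T C)) \<le> s
    \<and> finite (verts (T C))"
  shows "\<exists>N::nat. \<forall>(G :: nat graph) \<phi>. finite (verts G) \<and>
    disjoint_family_on (\<lambda>k. \<phi> k ` verts (T (fst k))) (components H \<times> {..<N}) \<and>
    (\<forall>k \<in> components H \<times> {..<N}. inj_on (\<phi> k) (verts (T (fst k))) \<and> \<phi> k ` verts (T (fst k)) \<subseteq> verts G \<and>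
      (\<forall>a\<in>edges (T (fst k)). \<phi> k ` a \<in> edges G)) \<longrightarrow> client_wins b H G"
proof -
  let ?J = "\<lambda>N. components H \<times> {..<N}"
  obtain N :: nat where N: "\<forall>(U :: nat set) V W B W'. finite U \<and> V \<subseteq> U \<and> card V \<le> 0 \<and> client_forces b W V {} \<and>
      disjoint_family_on B (components H \<times> {..<N}) \<and>
      (\<forall>k \<in> components H \<times> {..<N}. B k \<subseteq> U \<and> V \<inter> B k = {} \<and> card (B k) \<le> s \<and> client_forces b (W' k) (B k) {}) \<longrightarrow>
    client_forces b (\<lambda>S. W (S \<inter> V) \<and> (\<forall>i\<in>components H. \<exists>t<N. W' (i, t) (S \<inter> B (i, t)))) U {}"
    using client_forces_many[OF finite_components[OF assms(1)], where r = 0 and b = b and s = s and ?'v = nat]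
    by (rule exE)
  show ?thesis
  proof (intro exI[of _ N] allI impI, elim conjE)
    fix G :: "nat graph" and \<phi>
    assume fin: "finite (verts G)"
      and dis: "disjoint_family_on (\<lambda>k. \<phi> k ` verts (T (fst k))) (?J N)"
      and \<phi>: "\<forall>k \<in> ?J N. inj_on (\<phi> k) (verts (T (fst k))) \<and> \<phi> k ` verts (T (fst k)) \<subseteq> verts G \<and>
        (\<forall>a\<in>edges (T (fst k)). \<phi> k ` a \<in> edges G)"
    define B where "B k = \<phi> k ` verts (T (fst k))" for k
    have "client_forces b (\<lambda>S. True \<and> (\<forall>C\<in>components H. \<exists>t<N.
        contains_copy (induced H (fst (C, t))) G (S \<inter> B (C, t)))) (verts G) {}"
    \<comment> \<open>The main board is empty and its goal always holds; everything is achieved on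
      the auxiliary boards, one family for each component of \<open>H\<close>.\<close>
    proof (rule N[rule_format, of "verts G" "{}" "\<lambda>_. True" B "\<lambda>k. contains_copy (induced H (fst k)) G"],
        intro conjI ballI)
      show "client_forces b (\<lambda>_. True) {} {}" by (simp add: client_forces_empty_iff)
      show "disjoint_family_on B (?J N)" using dis by (simp add: B_def[abs_def])
      fix k assume k: "k \<in> ?J N"
      then have C: "fst k \<in> components H" by auto
      note \<phi>k = bspec[OF \<phi> k]
      show "B k \<subseteq> verts G" using \<phi>k by (simp add: B_def)
      show "card (B k) \<le> s"
        using card_image_le[of "verts (T (fst k))" "\<phi> k"] assms(2)[OF C] by (simp add: B_def)
      show "client_forces b (contains_copy (induced H (fst k)) G) (B k) {}"
        unfolding B_def using assms(2)[OF C] \<phi>k by (intro client_forces_on_copy[where T = "T (fst k)"]) simp_all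
    qed (use fin in auto)
    then have "client_forces b (contains_copy H G) (verts G) {}"
    proof (rule client_forces_mono)
      fix S assume "True \<and> (\<forall>C\<in>components H. \<exists>t<N. contains_copy (induced H (fst (C, t))) G (S \<inter> B (C, t)))"
      then have "\<forall>C\<in>components H. \<exists>t. t < N \<and> contains_copy (induced H C) G (S \<inter> B (C, t))"
        by simp
      from bchoice[OF this] obtain t where
        t: "\<forall>C\<in>components H. t C < N \<and> contains_copy (induced H C) G (S \<inter> B (C, t C))" by (rule exE)
      show "contains_copy H G S"
      proof (rule contains_copy_from_components[OF assms(1)])
        show "disjoint_family_on (\<lambda>C. B (C, t C)) (components H)"
          unfolding disjoint_family_on_def
        proof (intro ballI impI)
          fix C D assume "C \<in> components H" "D \<in> components H" "C \<noteq> D"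
          then show "B (C, t C) \<inter> B (D, t D) = {}"
            unfolding B_def using t by (intro disjoint_family_onD[OF dis]) simp_all
        qed
      qed (use t in simp)
    qed
    then show "client_wins b H G" by (simp add: client_wins_def cw_pos_iff_client_forces)
  qed
qed

subsection \<open>The binomial random graph\<close>

abbreviation gnp_weight :: "nat \<Rightarrow> real \<Rightarrow> nat set set \<Rightarrow> real" where
  "gnp_weight n p E \<equiv> p ^ card E * (1 - p) ^ (card (all_pairs n) - card E)"

lemma finite_all_pairs: "finite (all_pairs n)"
  by (rule finite_subset[of _ "Pow {0..<n}"]) (auto simp: all_pairs_def)

lemma wf_graph_Gnp: "E \<subseteq> all_pairs n \<Longrightarrow> wf_graph ({0..<n}, E)"
  by (auto simp: wf_graph_def all_pairs_def)

text \<open>Expand the product over \<open>A\<close> of \<open>p + g x\<close>, where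
  \<open>g\<close> is 0 on \<open>D\<close> and \<open>1 - p\<close> elsewhere: the zeros delete
  exactly the subsets that miss an element of \<open>D\<close>. The case of empty \<open>D\<close>
  says that the weights sum to 1.\<close>

lemma sum_Pow_superset:
  fixes p :: real
  assumes "finite A" "D \<subseteq> A"
  shows "(\<Sum>E\<in>Pow A. if D \<subseteq> E then p ^ card E * (1 - p) ^ (card A - card E) else 0) = p ^ card D"
proof -
  let ?g = "\<lambda>x. if x \<in> D then 0 else 1 - p"
  have "p ^ card D = (\<Prod>x\<in>D. p)" by simp
  also have "\<dots> = (\<Prod>x\<in>A. if x \<in> D then p else 1)"
    using assms by (simp add: prod.If_cases Int_absorb1)
  also have "\<dots> = (\<Prod>x\<in>A. p + ?g x)" by (intro prod.cong) auto
  also have "\<dots> = (\<Sum>E\<in>Pow A. (\<Prod>x\<in>E. p) * (\<Prod>x\<in>A - E. ?g x))"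
    by (rule prod_add) (rule assms(1))
  also have "\<dots> = (\<Sum>E\<in>Pow A. if D \<subseteq> E then p ^ card E * (1 - p) ^ (card A - card E) else 0)"
  proof (intro sum.cong refl)
    fix E assume "E \<in> Pow A"
    then have E: "E \<subseteq> A" "finite E" using assms finite_subset by auto
    show "(\<Prod>x\<in>E. p) * (\<Prod>x\<in>A - E. ?g x) = (if D \<subseteq> E then p ^ card E * (1 - p) ^ (card A - card E) else 0)"
    proof (cases "D \<subseteq> E")
      case True
      have "(\<Prod>x\<in>A - E. ?g x) = (\<Prod>x\<in>A - E. 1 - p)" using True by (intro prod.cong) auto
      then show ?thesis using True E by (simp add: card_Diff_subset)
    next
      case False
      then obtain x where "x \<in> A - E" "x \<in> D" using assms by auto
      then have "(\<Prod>x\<in>A - E. ?g x) = 0" using assms(1) by (intro prod_zero) auto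
      then show ?thesis using False by simp
    qed
  qed
  finally show ?thesis by simp
qed

section \<open>Basic inequalities for probabilities in the binomial random graph\<close>

lemma prob_Gnp_superset:
  assumes "D \<subseteq> all_pairs n"
  shows "prob_Gnp n p (\<lambda>G. D \<subseteq> edges G) = p ^ card D"
  using sum_Pow_superset[OF finite_all_pairs assms] by (simp add: prob_Gnp_def)

lemma sum_gnp_weight: "(\<Sum>E\<in>Pow (all_pairs n). gnp_weight n p E) = 1"
  using sum_Pow_superset[OF finite_all_pairs[of n], of "{}" p] by simp

lemma prob_Gnp_not: "prob_Gnp n p (\<lambda>G. \<not> P G) = 1 - prob_Gnp n p P"
proof -
  have "prob_Gnp n p (\<lambda>G. \<not> P G) + prob_Gnp n p P = (\<Sum>E\<in>Pow (all_pairs n). gnp_weight n p E)"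
    unfolding prob_Gnp_def sum.distrib[symmetric] by (intro sum.cong) auto
  then show ?thesis using sum_gnp_weight[where n = n and p = p] by linarith
qed

lemma prob_Gnp_nonneg: "0 \<le> p \<Longrightarrow> p \<le> 1 \<Longrightarrow> 0 \<le> prob_Gnp n p P"
  unfolding prob_Gnp_def by (intro sum_nonneg) auto

lemma prob_Gnp_le_1: "0 \<le> p \<Longrightarrow> p \<le> 1 \<Longrightarrow> prob_Gnp n p P \<le> 1"
  using prob_Gnp_nonneg[of p n "\<lambda>G. \<not> P G"] prob_Gnp_not[of n p P] by linarith

lemma prob_Gnp_mono:
  assumes "0 \<le> p" "p \<le> 1" "\<And>E. E \<subseteq> all_pairs n \<Longrightarrow> P ({0..<n}, E) \<Longrightarrow> Q ({0..<n}, E)"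
  shows "prob_Gnp n p P \<le> prob_Gnp n p Q"
  unfolding prob_Gnp_def using assms by (intro sum_mono) auto

lemma prob_Gnp_union_bound:
  assumes "0 \<le> p" "p \<le> 1" "finite I"
  shows "prob_Gnp n p (\<lambda>G. \<exists>i\<in>I. P i G) \<le> (\<Sum>i\<in>I. prob_Gnp n p (P i))"
proof -
  have "(if \<exists>i\<in>I. P i G then x else 0) \<le> (\<Sum>i\<in>I. if P i G then x else 0)" if "0 \<le> (x :: real)" for x G
  proof (cases "\<exists>i\<in>I. P i G")
    case True
    then obtain i where i: "i \<in> I" "P i G" by auto
    then have "x = (if P i G then x else 0)" by simp
    also have "\<dots> \<le> (\<Sum>i\<in>I. if P i G then x else 0)"
      using that assms(3) i(1) by (intro member_le_sum) auto
    finally show ?thesis using True by simp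
  next
    case False
    then show ?thesis using that by (simp add: sum_nonneg)
  qed
  then have "prob_Gnp n p (\<lambda>G. \<exists>i\<in>I. P i G) \<le>
      (\<Sum>E\<in>Pow (all_pairs n). \<Sum>i\<in>I. if P i ({0..<n}, E) then gnp_weight n p E else 0)"
    unfolding prob_Gnp_def using assms by (intro sum_mono) auto
  also have "\<dots> = (\<Sum>i\<in>I. prob_Gnp n p (P i))"
    unfolding prob_Gnp_def by (rule sum.swap)
  finally show ?thesis .
qed

text \<open>Chebyshev's inequality for the number \<open>X\<close> of sets \<open>D f\<close> that
  are present: if there are none, the squared deviation equals the squared mean
  \<open>\<mu>\<close>. It is stated multiplied out, which avoids dividing by the mean.\<close>

lemma prob_Gnp_second_moment:
  fixes D :: "'i \<Rightarrow> nat set set" and p :: real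
  assumes "0 \<le> p" "p \<le> 1" "finite F" "\<And>f. f \<in> F \<Longrightarrow> D f \<subseteq> all_pairs n \<and> card (D f) = e"
  shows "prob_Gnp n p (\<lambda>G. \<forall>f\<in>F. \<not> D f \<subseteq> edges G) * (card F * p ^ e)\<^sup>2
    \<le> (\<Sum>f\<in>F. \<Sum>g\<in>F. p ^ card (D f \<union> D g)) - (card F * p ^ e)\<^sup>2"
proof -
  define \<mu> where "\<mu> = card F * p ^ e"
  define X :: "nat set set \<Rightarrow> real" where "X E = (\<Sum>f\<in>F. if D f \<subseteq> E then 1 else 0)" for E
  let ?w = "gnp_weight n p"
  let ?P = "Pow (all_pairs n)"
  have ind: "(\<Sum>E\<in>?P. ?w E * (if A \<subseteq> E then 1 else 0)) = p ^ card A" if "A \<subseteq> all_pairs n" for A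
    using sum_Pow_superset[OF finite_all_pairs that, of p] by (simp add: if_distrib cong: if_cong)
  have EX: "(\<Sum>E\<in>?P. ?w E * X E) = \<mu>"
  proof -
    have "(\<Sum>E\<in>?P. ?w E * X E) = (\<Sum>f\<in>F. \<Sum>E\<in>?P. ?w E * (if D f \<subseteq> E then 1 else 0))"
      unfolding X_def sum_distrib_left by (rule sum.swap)
    also have "\<dots> = (\<Sum>f\<in>F. p ^ e)" using ind assms(4) by (intro sum.cong) auto
    finally show ?thesis by (simp add: \<mu>_def)
  qed
  have EX2: "(\<Sum>E\<in>?P. ?w E * (X E)\<^sup>2) = (\<Sum>f\<in>F. \<Sum>g\<in>F. p ^ card (D f \<union> D g))"
  proof -
    have "(X E)\<^sup>2 = (\<Sum>f\<in>F. \<Sum>g\<in>F. if D f \<union> D g \<subseteq> E then 1 else 0)" for E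
      unfolding X_def power2_eq_square sum_product by (intro sum.cong) auto
    then have "(\<Sum>E\<in>?P. ?w E * (X E)\<^sup>2) =
        (\<Sum>E\<in>?P. \<Sum>f\<in>F. \<Sum>g\<in>F. ?w E * (if D f \<union> D g \<subseteq> E then 1 else 0))"
      by (simp only: sum_distrib_left)
    also have "\<dots> = (\<Sum>f\<in>F. \<Sum>E\<in>?P. \<Sum>g\<in>F. ?w E * (if D f \<union> D g \<subseteq> E then 1 else 0))"
      by (rule sum.swap)
    also have "\<dots> = (\<Sum>f\<in>F. \<Sum>g\<in>F. \<Sum>E\<in>?P. ?w E * (if D f \<union> D g \<subseteq> E then 1 else 0))"
      by (intro sum.cong refl sum.swap)
    also have "\<dots> = (\<Sum>f\<in>F. \<Sum>g\<in>F. p ^ card (D f \<union> D g))"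
      using assms(4) by (intro sum.cong refl ind) auto
    finally show ?thesis .
  qed
  have "prob_Gnp n p (\<lambda>G. \<forall>f\<in>F. \<not> D f \<subseteq> edges G) * \<mu>\<^sup>2 =
      (\<Sum>E\<in>?P. (if \<forall>f\<in>F. \<not> D f \<subseteq> E then ?w E else 0) * \<mu>\<^sup>2)"
    unfolding prob_Gnp_def sum_distrib_right by simp
  also have "\<dots> \<le> (\<Sum>E\<in>?P. ?w E * (X E - \<mu>)\<^sup>2)"
  proof (rule sum_mono)
    fix E
    have w: "0 \<le> ?w E" using assms by simp
    show "(if \<forall>f\<in>F. \<not> D f \<subseteq> E then ?w E else 0) * \<mu>\<^sup>2 \<le> ?w E * (X E - \<mu>)\<^sup>2"
    proof (cases "\<forall>f\<in>F. \<not> D f \<subseteq> E")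
      case True
      then have "X E = 0" by (auto simp: X_def intro!: sum.neutral)
      then show ?thesis using True by simp
    next
      case False
      have "0 \<le> ?w E * (X E - \<mu>)\<^sup>2" by (rule mult_nonneg_nonneg[OF w zero_le_power2])
      with False show ?thesis by (simp only: if_False mult_zero_left)
    qed
  qed
  also have "\<dots> = (\<Sum>E\<in>?P. ?w E * (X E)\<^sup>2 - 2 * \<mu> * (?w E * X E) + \<mu>\<^sup>2 * ?w E)"
    by (intro sum.cong refl) (simp add: power2_eq_square algebra_simps)
  also have "\<dots> = (\<Sum>E\<in>?P. ?w E * (X E)\<^sup>2) - 2 * \<mu> * (\<Sum>E\<in>?P. ?w E * X E) + \<mu>\<^sup>2 * (\<Sum>E\<in>?P. ?w E)"
    by (simp only: sum.distrib sum_subtractf sum_distrib_left)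
  also have "\<dots> = (\<Sum>f\<in>F. \<Sum>g\<in>F. p ^ card (D f \<union> D g)) - \<mu>\<^sup>2"
    unfolding EX EX2 sum_gnp_weight by (simp add: power2_eq_square)
  finally show ?thesis unfolding \<mu>_def .
qed

text \<open>Only transversal copies are counted, the vertex \<open>i\<close> being sent into its own class \<open>S i\<close>.  Then
  two copies share exactly the edges spanned by the vertices on which they agree, and a set of
  \<open>k \<ge> 1\<close> vertices of a tree spans at most \<open>k - 1\<close> edges.\<close>

lemma prob_no_transversal_copy:
  fixes S :: "'v \<Rightarrow> nat set" and p q :: real
  assumes "leaf_grown V E" "disjoint_family_on S V" "\<And>i. i \<in> V \<Longrightarrow> S i \<subseteq> {0..<n} \<and> card (S i) = m"
    and p: "0 < p" "p \<le> 1" and q: "0 < q" "\<And>k. 1 \<le> k \<Longrightarrow> k \<le> card V \<Longrightarrow> q \<le> real m ^ k * p ^ (k - 1)"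
  shows "prob_Gnp n p (\<lambda>G. \<forall>f\<in>Pi\<^sub>E V S. \<not> (\<forall>a\<in>E. f ` a \<in> edges G)) \<le> 2 ^ card V / q"
proof -
  note wf = leaf_grown_wf[OF assms(1)]
  define F where "F = Pi\<^sub>E V S"
  define D where "D f = (\<lambda>a. f ` a) ` E" for f :: "'v \<Rightarrow> nat"
  define e where "e = card E"
  have finS: "finite (S i)" if "i \<in> V" for i using assms(3)[OF that] finite_subset by blast
  have finF: "finite F" unfolding F_def using wf finS by (intro finite_PiE) auto
  have cardF: "card F = m ^ card V"
    unfolding F_def using wf assms(3) by (subst card_PiE) auto
  have Fmem: "f i \<in> S i" if "f \<in> F" "i \<in> V" for f i using that by (auto simp: F_def)
  \<comment> \<open>Because the classes are disjoint, an image vertex determines its preimage. This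
    makes each \<open>f\<close> injective and forces two copies that share an edge to agree on both
    its ends.\<close>
  have class_eq: "i = j" if "f \<in> F" "g \<in> F" "i \<in> V" "j \<in> V" "f i = g j" for f g i j
    using Fmem[OF that(1,3)] Fmem[OF that(2,4)] that assms(2) unfolding disjoint_family_on_def by auto
  have inj: "inj_on f V" if "f \<in> F" for f
    using class_eq[OF that that] by (auto simp: inj_on_def)
  have same: "a = c \<and> (\<forall>i\<in>a. f i = g i)" if fg: "f \<in> F" "g \<in> F" and ac: "a \<in> E" "c \<in> E" "f ` a = g ` c"
    for f g a c
  proof -
    have sub: "a \<subseteq> V" "c \<subseteq> V" using wf ac by auto
    have 1: "i \<in> c \<and> f i = g i" if "i \<in> a" for i
    proof -
      have "f i \<in> g ` c" using that ac(3) by auto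
      then obtain j where j: "j \<in> c" "f i = g j" by auto
      then show ?thesis using class_eq[OF fg, of i j] sub that by auto
    qed
    have 2: "i \<in> a" if "i \<in> c" for i
    proof -
      have "g i \<in> f ` a" using that ac(3) by auto
      then obtain j where j: "j \<in> a" "f j = g i" by auto
      then show ?thesis using class_eq[OF fg, of j i] sub that by auto
    qed
    show ?thesis using 1 2 by auto
  qed
  have D: "D f \<subseteq> all_pairs n \<and> card (D f) = e" if f: "f \<in> F" for f
  proof
    have "inj_on (\<lambda>a. f ` a) E" using same[OF f f] by (auto intro!: inj_onI)
    then show "card (D f) = e" by (simp add: D_def e_def card_image)
    show "D f \<subseteq> all_pairs n"
    proof
      fix x assume "x \<in> D f"
      then obtain a where a: "a \<in> E" "x = f ` a" by (auto simp: D_def)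
      have aV: "a \<subseteq> V" "card a = 2" using wf a by auto
      then have "card x = 2" using a inj_on_subset[OF inj[OF f]] by (simp add: card_image)
      moreover have "x \<subseteq> {0..<n}" using a aV Fmem[OF f] assms(3) by blast
      ultimately show "x \<in> all_pairs n" by (simp add: all_pairs_def)
    qed
  qed
  define Q where "Q = Pow V - {{}}"
  have finQ: "finite Q" using wf by (simp add: Q_def)
  let ?I = "\<lambda>f g. {i \<in> V. f i = g i}"
  let ?term = "\<lambda>f g I. if \<forall>i\<in>I. f i = g i then 1 / p ^ (card I - 1) else (0 :: real)"
  \<comment> \<open>The exact agreement set of \<open>f\<close> and \<open>g\<close> is replaced by
    a sum over all nonempty \<open>I\<close> on which they agree: its own term is among the summands
    and the others are nonnegative. That sum can be exchanged with the one over \<open>g\<close>.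
    The summand 1 covers pairs that agree nowhere.\<close>
  have pair: "p ^ card (D f \<union> D g) \<le> p ^ (2 * e) * (1 + (\<Sum>I\<in>Q. ?term f g I))"
    if f: "f \<in> F" and g: "g \<in> F" for f g
  proof -
    have fin: "finite (D f)" "finite (D g)" using wf by (auto simp: D_def)
    have "D f \<inter> D g \<subseteq> (\<lambda>a. f ` a) ` {a \<in> E. a \<subseteq> ?I f g}"
    proof
      fix x assume x: "x \<in> D f \<inter> D g"
      then obtain a c where ac: "a \<in> E" "c \<in> E" "x = f ` a" "x = g ` c" by (auto simp: D_def)
      then have "\<forall>i\<in>a. f i = g i" using same[OF f g ac(1,2)] by simp
      moreover have "a \<subseteq> V" using wf ac by auto
      ultimately have "a \<in> {a \<in> E. a \<subseteq> ?I f g}" using ac by auto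
      then show "x \<in> (\<lambda>a. f ` a) ` {a \<in> E. a \<subseteq> ?I f g}" unfolding ac(3) by (rule imageI)
    qed
    then have "card (D f \<inter> D g) \<le> card ((\<lambda>a. f ` a) ` {a \<in> E. a \<subseteq> ?I f g})"
      using wf by (intro card_mono) auto
    also have "\<dots> \<le> card {a \<in> E. a \<subseteq> ?I f g}" using wf by (intro card_image_le) auto
    also have "\<dots> \<le> card (?I f g) - 1" by (rule leaf_grown_edges_inside[OF assms(1)]) auto
    finally have k: "card (D f \<inter> D g) \<le> card (?I f g) - 1" .
    have "p ^ card (D f \<union> D g) * p ^ card (D f \<inter> D g) = p ^ (2 * e)"
      using card_Un_Int[OF fin] D[OF f] D[OF g] by (simp add: mult_2 flip: power_add)
    then have "p ^ card (D f \<union> D g) = p ^ (2 * e) * (1 / p ^ card (D f \<inter> D g))"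
      using p by (simp add: field_simps)
    also have "\<dots> \<le> p ^ (2 * e) * (1 + (\<Sum>I\<in>Q. ?term f g I))"
    proof (rule mult_left_mono)
      have nn: "0 \<le> ?term f g I" for I using p by simp
      show "1 / p ^ card (D f \<inter> D g) \<le> 1 + (\<Sum>I\<in>Q. ?term f g I)"
      proof (cases "?I f g = {}")
        case True
        then have "card (D f \<inter> D g) = 0" using k by (simp only: card.empty)
        then have "1 / p ^ card (D f \<inter> D g) = 1" by simp
        moreover have "0 \<le> (\<Sum>I\<in>Q. ?term f g I)" by (intro sum_nonneg nn)
        ultimately show ?thesis by linarith
      next
        case False
        then have "?I f g \<in> Q" by (auto simp: Q_def)
        then have "?term f g (?I f g) \<le> (\<Sum>I\<in>Q. ?term f g I)"
          using finQ nn by (intro member_le_sum) auto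
        moreover have "1 / p ^ card (D f \<inter> D g) \<le> 1 / p ^ (card (?I f g) - 1)"
          using p k by (intro divide_left_mono power_decreasing) auto
        ultimately show ?thesis by simp
      qed
    qed (use p in auto)
    finally show ?thesis .
  qed
  \<comment> \<open>Prescribing \<open>g\<close> on \<open>I\<close> leaves
    \<open>m ^ (card V - card I)\<close> choices, so the sum is \<open>m ^ card V\<close> divided by
    \<open>m ^ card I * p ^ (card I - 1)\<close>. The divisor is the expected number of transversal
    copies of a tree with \<open>card I\<close> vertices, which \<open>q\<close> bounds from
    below.\<close>
  have one: "(\<Sum>g\<in>F. ?term f g I) \<le> real m ^ card V / q" if f: "f \<in> F" and I: "I \<in> Q" for f I
  proof -
    have IV: "I \<subseteq> V" "I \<noteq> {}" "finite I" using I wf finite_subset by (auto simp: Q_def)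
    have cI: "1 \<le> card I" "card I \<le> card V" using IV wf by (auto simp: Suc_le_eq card_gt_0_iff card_mono)
    have m0: "0 < real m ^ card I" 
      using q(2)[OF cI] q(1) p by (metis less_le_trans mult_pos_pos zero_less_mult_pos2 zero_less_power)
    have eq: "{g \<in> F. \<forall>i\<in>I. f i = g i} = (\<Pi>\<^sub>E i\<in>V. if i \<in> I then {f i} else S i)"
      using f IV(1) unfolding F_def PiE_def Pi_def by (auto split: if_splits)
    have "card {g \<in> F. \<forall>i\<in>I. f i = g i} = (\<Prod>i\<in>V. if i \<in> I then 1 else m)"
      unfolding eq card_PiE[OF conjunct1[OF wf]] by (intro prod.cong refl) (simp add: assms(3))
    also have "\<dots> = m ^ card (V - I)"
      using wf by (simp add: prod.If_cases Diff_eq)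
    also have "card (V - I) = card V - card I" using IV by (simp add: card_Diff_subset)
    finally have cnt: "card {g \<in> F. \<forall>i\<in>I. f i = g i} = m ^ (card V - card I)" .
    have "(\<Sum>g\<in>F. ?term f g I) = (\<Sum>g\<in>{g \<in> F. \<forall>i\<in>I. f i = g i}. 1 / p ^ (card I - 1))"
      by (rule sum.inter_filter[OF finF, symmetric])
    also have "\<dots> = real m ^ (card V - card I) / p ^ (card I - 1)" using cnt by simp
    also have "\<dots> = real m ^ card V / (real m ^ card I * p ^ (card I - 1))"
    proof -
      have "real m ^ card V = real m ^ (card V - card I) * real m ^ card I"
        using cI by (simp flip: power_add)
      then show ?thesis using m0 by simp
    qed
    also have "\<dots> \<le> real m ^ card V / q"
      using q cI m0 p by (intro divide_left_mono mult_pos_pos) auto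
    finally show ?thesis .
  qed
  have "(\<Sum>f\<in>F. \<Sum>g\<in>F. p ^ card (D f \<union> D g)) \<le> (\<Sum>f\<in>F. \<Sum>g\<in>F. p ^ (2 * e) * (1 + (\<Sum>I\<in>Q. ?term f g I)))"
    by (intro sum_mono pair)
  also have "\<dots> = (\<Sum>f\<in>F. p ^ (2 * e) * (card F + (\<Sum>I\<in>Q. \<Sum>g\<in>F. ?term f g I)))"
  proof (intro sum.cong refl)
    fix f
    have "(\<Sum>g\<in>F. \<Sum>I\<in>Q. ?term f g I) = (\<Sum>I\<in>Q. \<Sum>g\<in>F. ?term f g I)" by (rule sum.swap)
    then show "(\<Sum>g\<in>F. p ^ (2 * e) * (1 + (\<Sum>I\<in>Q. ?term f g I))) =
        p ^ (2 * e) * (card F + (\<Sum>I\<in>Q. \<Sum>g\<in>F. ?term f g I))"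
      by (simp only: sum_distrib_left[symmetric] sum.distrib) simp
  qed
  also have "\<dots> \<le> (\<Sum>f\<in>F. p ^ (2 * e) * (card F + (\<Sum>I\<in>Q. real m ^ card V / q)))"
    using p by (intro sum_mono mult_left_mono add_left_mono one) auto
  also have "\<dots> = (card F * p ^ e)\<^sup>2 * (1 + card Q / q)"
  proof -
    have "real m ^ card V = real (card F)" "p ^ (2 * e) = p ^ e * p ^ e"
      by (simp_all add: cardF mult_2 power_add)
    then show ?thesis
      by (simp only: sum_constant power2_eq_square) (simp add: distrib_left mult_ac)
  qed
  finally have tot: "(\<Sum>f\<in>F. \<Sum>g\<in>F. p ^ card (D f \<union> D g)) \<le> (card F * p ^ e)\<^sup>2 * (1 + card Q / q)" .
  let ?Pr = "prob_Gnp n p (\<lambda>G. \<forall>f\<in>F. \<not> D f \<subseteq> edges G)"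
  have "?Pr * (card F * p ^ e)\<^sup>2 \<le> (\<Sum>f\<in>F. \<Sum>g\<in>F. p ^ card (D f \<union> D g)) - (card F * p ^ e)\<^sup>2"
    using p D by (intro prob_Gnp_second_moment finF) auto
  also have "\<dots> \<le> (card Q / q) * (card F * p ^ e)\<^sup>2" using tot by (simp add: algebra_simps)
  finally have "?Pr * (card F * p ^ e)\<^sup>2 \<le> (card Q / q) * (card F * p ^ e)\<^sup>2" .
  moreover have "0 < (card F * p ^ e)\<^sup>2"
  proof -
    have "0 < card V" using wf by (simp add: card_gt_0_iff)
    \<comment> \<open>For \<open>k = 1\<close> the hypothesis on \<open>q\<close> reads
      \<open>q \<le> m\<close>, so the classes are nonempty.\<close>
    then have "0 < m" using q(2)[of 1] q(1) by (cases "m = 0") auto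
    then show ?thesis using p by (simp add: cardF)
  qed
  ultimately have "?Pr \<le> card Q / q" by (rule mult_right_le_imp_le)
  also have "\<dots> \<le> 2 ^ card V / q"
  proof -
    have "card Q \<le> card (Pow V)" unfolding Q_def using wf by (intro card_mono) auto
    then have "card Q \<le> 2 ^ card V" using wf by (simp add: card_Pow)
    then have "real (card Q) \<le> real (2 ^ card V)" by (simp only: of_nat_le_iff)
    then have "real (card Q) \<le> 2 ^ card V" by simp
    then show ?thesis using q by (intro divide_right_mono) auto
  qed
  finally show ?thesis by (simp add: F_def D_def image_subset_iff)
qed

text \<open>First moment bound over pairs of an \<open>l\<close>-set \<open>S\<close> and
  \<open>k\<close> edges inside it. The factor \<open>2 ^ 2 ^ l\<close>, the number of families of
  subsets of \<open>S\<close>, is a crude count of the edge choices that does not depend on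
  \<open>n\<close>.\<close>

lemma prob_dense_set:
  assumes "0 \<le> p" "p \<le> 1"
  shows "prob_Gnp n p (\<lambda>G. \<exists>S\<subseteq>verts G. card S = l \<and> k \<le> card {a \<in> edges G. a \<subseteq> S})
    \<le> 2 ^ 2 ^ l * (real n ^ l * p ^ k)"
proof -
  define \<S> where "\<S> = {S. S \<subseteq> {0..<n} \<and> card S = l}"
  define I where "I = {(S, D). S \<in> \<S> \<and> D \<subseteq> Pow S \<and> D \<subseteq> all_pairs n \<and> card D = k}"
  have finS: "finite \<S>" unfolding \<S>_def by (rule finite_subset[of _ "Pow {0..<n}"]) auto
  have finmem: "finite S" if "S \<in> \<S>" for S using that by (auto simp: \<S>_def intro: finite_subset)
  have sub: "I \<subseteq> Sigma \<S> (\<lambda>S. Pow (Pow S))" by (auto simp: I_def)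
  have finSig: "finite (Sigma \<S> (\<lambda>S. Pow (Pow S)))" using finS finmem by auto
  have finI: "finite I" using sub finSig finite_subset by blast
  have "card I \<le> card (Sigma \<S> (\<lambda>S. Pow (Pow S)))" by (rule card_mono[OF finSig sub])
  also have "\<dots> = (\<Sum>S\<in>\<S>. card (Pow (Pow S)))" using finS finmem by (simp add: card_SigmaI)
  also have "\<dots> = (\<Sum>S\<in>\<S>. 2 ^ 2 ^ l)"
    using finmem by (intro sum.cong) (auto simp: card_Pow \<S>_def)
  also have "\<dots> = (n choose l) * 2 ^ 2 ^ l" using n_subsets[of "{0..<n}" l] by (simp add: \<S>_def)
  also have "\<dots> \<le> n ^ l * 2 ^ 2 ^ l"
    using binomial_le_pow[of l n] by (cases "l \<le> n") (auto simp: binomial_eq_0)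
  finally have cI: "card I \<le> n ^ l * 2 ^ 2 ^ l" .
  have "prob_Gnp n p (\<lambda>G. \<exists>S\<subseteq>verts G. card S = l \<and> k \<le> card {a \<in> edges G. a \<subseteq> S})
      \<le> prob_Gnp n p (\<lambda>G. \<exists>i\<in>I. snd i \<subseteq> edges G)"
  proof (rule prob_Gnp_mono[OF assms])
    fix E assume E: "E \<subseteq> all_pairs n"
      and "\<exists>S\<subseteq>verts ({0..<n}, E). card S = l \<and> k \<le> card {a \<in> edges ({0..<n}, E). a \<subseteq> S}"
    then obtain S where S: "S \<subseteq> {0..<n}" "card S = l" "k \<le> card {a \<in> E. a \<subseteq> S}" by auto
    obtain D where D: "D \<subseteq> {a \<in> E. a \<subseteq> S}" "card D = k" using S(3) by (meson obtain_subset_with_card_n)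
    have "(S, D) \<in> I" using S D E by (auto simp: I_def \<S>_def)
    then show "\<exists>i\<in>I. snd i \<subseteq> edges ({0..<n}, E)" using D by (intro bexI[of _ "(S, D)"]) auto
  qed
  also have "\<dots> \<le> (\<Sum>i\<in>I. prob_Gnp n p (\<lambda>G. snd i \<subseteq> edges G))"
    by (rule prob_Gnp_union_bound[OF assms finI])
  also have "\<dots> = (\<Sum>i\<in>I. p ^ k)"
    by (intro sum.cong refl) (auto simp: prob_Gnp_superset I_def)
  also have "\<dots> = real (card I) * p ^ k" by simp
  also have "\<dots> \<le> real (n ^ l * 2 ^ 2 ^ l) * p ^ k"
    using cI assms by (intro mult_right_mono) (simp_all only: of_nat_le_iff zero_le_power)
  finally show ?thesis by (simp add: algebra_simps)
qed

subsection \<open>Minimal trees\<close>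

lemma ex_min_client_tree:
  assumes "is_tree H"
  shows "\<exists>T. min_client_tree b H T"
proof -
  obtain T0 :: "nat graph" where "is_tree T0 \<and> client_wins b H T0" using tree_client_wins[OF assms, of b] by (rule exE)
  from ex_has_least_nat[where P = "\<lambda>T. is_tree T \<and> client_wins b H T" and m = "\<lambda>T. card (verts T)", OF this]
  show ?thesis unfolding min_client_tree_def conj_assoc .
qed

lemma min_client_tree_card_unique:
  assumes "min_client_tree b H T" "min_client_tree b H T'"
  shows "card (verts T) = card (verts T')"
  using assms unfolding min_client_tree_def by (meson le_antisym)

lemma ex_min_client_trees:
  assumes "is_forest H"
  obtains T where "\<And>C. C \<in> components H \<Longrightarrow> min_client_tree b (induced H C) (T C)"
proof -
  have "\<forall>C\<in>components H. \<exists>T. min_client_tree b (induced H C) T"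
    using ex_min_client_tree[OF component_of_forest_is_tree[OF assms]] by simp
  from bchoice[OF this] obtain T where "\<forall>C\<in>components H. min_client_tree b (induced H C) (T C)"
    by (rule exE)
  then show thesis using that[of T] by simp
qed

text \<open>All minimal trees of one component have the same size, so maximising over one chosen
  tree per component maximises over all of them.\<close>

lemma ex_Tmax:
  assumes "is_forest H" "verts H \<noteq> {}"
  shows "\<exists>T. is_Tmax b H T"
proof -
  obtain T where T: "\<And>C. C \<in> components H \<Longrightarrow> min_client_tree b (induced H C) (T C)"
    using ex_min_client_trees[OF assms(1), where b = b] by metis
  let ?c = "\<lambda>C. card (verts (T C))"
  have fin: "finite (?c ` components H)"
    using assms(1) finite_components[of H] by (simp add: is_forest_def)
  have "components H \<noteq> {}" using assms(2) Union_components[of H] by auto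
  then have "Max (?c ` components H) \<in> ?c ` components H" using fin by (intro Max_in) auto
  then obtain C where C: "C \<in> components H" "?c C = Max (?c ` components H)" by auto
  have "card (verts T') \<le> card (verts (T C))"
    if "D \<in> components H" "min_client_tree b (induced H D) T'" for D T'
    using min_client_tree_card_unique[OF that(2) T[OF that(1)]] C(2) fin that(1) by simp
  then have "is_Tmax b H (T C)" unfolding is_Tmax_def using C(1) T[OF C(1)] by auto
  then show ?thesis by (rule exI)
qed

text \<open>Follow a play in which Waiter offers only single vertices: Client's answers are forced,
  and the play still has to end in a winning set.\<close>

lemma client_forces_reachable:
  assumes "client_forces b W U C" shows "\<exists>S\<subseteq>U \<union> C. W S"
  using assms
proof induction
  case (offer U C)
  then obtain x where "x \<in> U" by auto
  then obtain S where "S \<subseteq> U - {x} \<union> insert x C" "W S" using offer(2)[of "{x}"] by auto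
  then show ?case using \<open>x \<in> U\<close> by blast
qed auto

lemma client_wins_card_le:
  assumes "client_wins b H T" "finite (verts T)"
  shows "card (verts H) \<le> card (verts T)"
proof -
  have "client_forces b (contains_copy H T) (verts T) {}"
    using assms(1) by (simp add: client_wins_def cw_pos_iff_client_forces)
  from client_forces_reachable[OF this] obtain S where "S \<subseteq> verts T" "contains_copy H T S" by auto
  then obtain f where "inj_on f (verts H)" "f ` verts H \<subseteq> verts T"
    unfolding contains_copy_def by (elim exE conjE) auto
  then show ?thesis using assms(2) card_inj_on_le by blast
qed

lemma card_le_Tmax:
  assumes "is_Tmax b H T" "C \<in> components H" "min_client_tree b (induced H C) T'"
  shows "card (verts T') \<le> card (verts T)"
  using assms unfolding is_Tmax_def by blast

text \<open>An edge of \<open>H\<close> gives a component with two vertices, and a board on which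
  Client wins contains a copy of it. So \<open>e = v - 1\<close> is positive and the exponent
  \<open>v / e\<close> is a genuine quotient.\<close>

lemma Tmax_card_ge_2:
  assumes "is_forest H" "edges H \<noteq> {}" "is_Tmax b H T"
  shows "2 \<le> card (verts T)"
proof -
  have wf: "wf_graph H" using assms(1) by (simp add: is_forest_def)
  obtain a where a: "a \<in> edges H" using assms(2) by auto
  obtain C where C: "C \<in> components H" "a \<subseteq> C" using edge_in_component[OF wf a] .
  obtain T' where T': "min_client_tree b (induced H C) T'"
    using ex_min_client_tree[OF component_of_forest_is_tree[OF assms(1) C(1)], of b] by (rule exE)
  have "finite C" using wf component_subset[OF C(1)] finite_subset by (auto simp: wf_graph_def)
  then have "2 \<le> card C" using card_mono[OF _ C(2)] wf a by (auto simp: wf_graph_def)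
  also have "\<dots> \<le> card (verts T')"
    using client_wins_card_le[of b "induced H C" T'] T'
    by (auto simp: min_client_tree_def is_tree_def is_forest_def wf_graph_def)
  also have "\<dots> \<le> card (verts T)" by (rule card_le_Tmax[OF assms(3) C(1) T'])
  finally show ?thesis .
qed

text \<open>A win for \<open>H\<close> would include a win for the component \<open>C\<close> whose
  minimal tree is \<open>T\<close>, whereas all components of \<open>G\<close> are trees smaller
  than \<open>T\<close>. The conditional bound merges the two sparsity conditions:
  \<open>l = v\<close> excludes trees on \<open>v\<close> vertices, \<open>l < v\<close> excludes as
  many edges as vertices.\<close>

lemma not_client_wins_sparse:
  fixes G :: "nat graph"
  assumes "is_forest H" "is_Tmax b H T" "wf_graph G" "v = card (verts T)" "1 \<le> v"
    and "\<And>l S. l \<in> {1..v} \<Longrightarrow> S \<subseteq> verts G \<Longrightarrow> card S = l \<Longrightarrow>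
      card {a \<in> edges G. a \<subseteq> S} < (if l = v then v - 1 else l)"
  shows "\<not> client_wins b H G"
proof
  assume win: "client_wins b H G"
  obtain C where C: "C \<in> components H" "min_client_tree b (induced H C) T"
    using assms(2) by (auto simp: is_Tmax_def)
  have tree: "is_tree (induced H C)" by (rule component_of_forest_is_tree[OF assms(1) C(1)])
  have "\<not> client_wins b (induced H C) G"
  proof (rule not_client_wins_if_not_on_components[OF assms(3)])
    fix K assume K: "K \<in> components G"
    have "is_tree (induced G K) \<and> card K < v"
    proof (rule sparse_components_are_small_trees[OF assms(3,5) _ _ K])
      fix S assume S: "S \<subseteq> verts G"
      show "card {a \<in> edges G. a \<subseteq> S} < v - 1" if "card S = v"
        using assms(6)[of v S] S that assms(5) by simp
      show "card {a \<in> edges G. a \<subseteq> S} < card S" if "1 \<le> card S" "card S < v"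
        using assms(6)[of "card S" S] S that by simp
    qed
    then have "is_tree (induced G K)" "\<not> card (verts T) \<le> card (verts (induced G K))"
      using assms(4) by simp_all
    then show "\<not> client_wins b (induced H C) (induced G K)"
      using C(2) unfolding min_client_tree_def by blast
  qed (use tree in \<open>auto simp: is_tree_def is_forest_def\<close>)
  then show False using client_wins_induced[OF win component_subset[OF C(1)]] by simp
qed

lemma prob_not_client_wins_ge:
  assumes "is_forest H" "is_Tmax b H T" "v = card (verts T)" "1 \<le> v" "0 \<le> p" "p \<le> 1"
  shows "1 - (\<Sum>l\<in>{1..v}. 2 ^ 2 ^ l * (real n ^ l * p ^ (if l = v then v - 1 else l)))
    \<le> prob_Gnp n p (\<lambda>G. \<not> client_wins b H G)"
proof -
  let ?k = "\<lambda>l. if l = v then v - 1 else l"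
  let ?bad = "\<lambda>l G. \<exists>S\<subseteq>verts G. card S = l \<and> ?k l \<le> card {a \<in> edges G. a \<subseteq> S}"
  have "prob_Gnp n p (client_wins b H) \<le> prob_Gnp n p (\<lambda>G. \<exists>l\<in>{1..v}. ?bad l G)"
  proof (rule prob_Gnp_mono[OF assms(5,6)])
    fix E assume E: "E \<subseteq> all_pairs n" "client_wins b H ({0..<n}, E)"
    show "\<exists>l\<in>{1..v}. ?bad l ({0..<n}, E)"
    proof (rule ccontr)
      assume "\<not> ?thesis"
      then have "\<not> client_wins b H ({0..<n}, E)"
        by (intro not_client_wins_sparse[OF assms(1,2) wf_graph_Gnp[OF E(1)] assms(3,4)])
          (auto simp: not_le)
      then show False using E by simp
    qed
  qed
  also have "\<dots> \<le> (\<Sum>l\<in>{1..v}. prob_Gnp n p (?bad l))"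
    by (rule prob_Gnp_union_bound[OF assms(5,6)]) simp
  also have "\<dots> \<le> (\<Sum>l\<in>{1..v}. 2 ^ 2 ^ l * (real n ^ l * p ^ ?k l))"
    by (intro sum_mono prob_dense_set assms(5,6))
  finally show ?thesis unfolding prob_Gnp_not by linarith
qed

text \<open>The vertex set is cut into equal intervals, one for every vertex of every required copy,
  so transversal copies are disjoint without further selection. \<open>K\<close> counts the copies
  and hence the failure events in the union bound; neither \<open>K\<close> nor \<open>L\<close>
  depends on \<open>n\<close> or \<open>p\<close>.\<close>

lemma prob_client_wins_ge:
  fixes H :: "'a graph" and T :: "'a set \<Rightarrow> nat graph"
  assumes "wf_graph H"
    and T: "\<And>C. C \<in> components H \<Longrightarrow> is_tree (T C) \<and> client_wins b (induced H C) (T C) \<and> card (verts (T C)) \<le> v"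
  shows "\<exists>(K :: nat) (L :: nat). 0 < L \<and> (\<forall>n (p :: real) q. 0 < p \<and> p \<le> 1 \<and> 0 < q \<and>
      (\<forall>k. 1 \<le> k \<and> k \<le> v \<longrightarrow> q \<le> real (n div L) ^ k * p ^ (k - 1)) \<longrightarrow>
      1 - real K * 2 ^ v / q \<le> prob_Gnp n p (client_wins b H))"
proof -
  have finT: "finite (verts (T C))" if "C \<in> components H" for C
    using T[OF that] by (auto simp: is_tree_def is_forest_def wf_graph_def)
  have "\<And>C. C \<in> components H \<Longrightarrow> client_wins b (induced H C) (T C) \<and> card (verts (T C)) \<le> v \<and> finite (verts (T C))"
    using T finT by simp
  from client_wins_if_many_copies[OF assms(1) this]
  obtain N :: nat where N: "\<forall>(G :: nat graph) \<phi>. finite (verts G) \<and>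
    disjoint_family_on (\<lambda>k. \<phi> k ` verts (T (fst k))) (components H \<times> {..<N}) \<and>
    (\<forall>k \<in> components H \<times> {..<N}. inj_on (\<phi> k) (verts (T (fst k))) \<and> \<phi> k ` verts (T (fst k)) \<subseteq> verts G \<and>
      (\<forall>a\<in>edges (T (fst k)). \<phi> k ` a \<in> edges G)) \<longrightarrow> client_wins b H G"
    by (rule exE)
  define J where "J = components H \<times> {..<N}"
  define V where "V k = verts (T (fst k))" for k :: "'a set \<times> nat"
  have finJ: "finite J" using finite_components[OF assms(1)] by (simp add: J_def)
  have finV: "finite (V k)" if "k \<in> J" for k using finT that by (auto simp: J_def V_def)
  define Q where "Q = Sigma J V"
  have finQ: "finite Q" unfolding Q_def by (rule finite_SigmaI[OF finJ finV])
  obtain h where h: "bij_betw h Q {0..<card Q}" using ex_bij_betw_finite_nat[OF finQ] by (rule exE)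
  \<comment> \<open>One more than the number of classes, so that dividing by \<open>L\<close> makes
    sense even when \<open>Q\<close> is empty.\<close>
  define L where "L = Suc (card Q)"
  have "1 - real (card J) * 2 ^ v / q \<le> prob_Gnp n p (client_wins b H)"
    if p: "0 < p" "p \<le> 1" and q: "0 < q" "\<forall>k. 1 \<le> k \<and> k \<le> v \<longrightarrow> q \<le> real (n div L) ^ k * p ^ (k - 1)"
    for n and p q :: real
  proof -
    define m where "m = n div L"
    define S where "S k i = {h (k, i) * m..<h (k, i) * m + m}" for k i
    have S_sub: "S k i \<subseteq> {0..<n}" if "k \<in> J" "i \<in> V k" for k i
    proof -
      have "h (k, i) < card Q" using h that bij_betwE[OF h] by (auto simp: Q_def)
      then have "h (k, i) + 1 \<le> L" by (simp add: L_def)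
      then have "(h (k, i) + 1) * m \<le> L * m" by (rule mult_le_mono1)
      also have "\<dots> \<le> n" by (simp add: m_def)
      finally show ?thesis by (auto simp: S_def)
    qed
    have S_disj: "k = k' \<and> i = i'"
      if "k \<in> J" "i \<in> V k" "k' \<in> J" "i' \<in> V k'" "x \<in> S k i" "x \<in> S k' i'" for k i k' i' x
    proof -
      \<comment> \<open>Integer division by the interval length recovers the class of a
        vertex.\<close>
      have "x div m = h (k, i)" "x div m = h (k', i')"
        using that(5,6) unfolding S_def by (auto intro!: div_nat_eqI simp: mult.commute)
      then have "h (k, i) = h (k', i')" by simp
      then have "(k, i) = (k', i')" using h that by (auto simp: bij_betw_def Q_def dest: inj_onD)
      then show ?thesis by simp
    qed
    define bad where "bad k G \<longleftrightarrow> (\<forall>f\<in>Pi\<^sub>E (V k) (S k). \<not> (\<forall>a\<in>edges (T (fst k)). f ` a \<in> edges G))"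
      for k and G :: "nat graph"
    have "prob_Gnp n p (\<lambda>G. \<not> client_wins b H G) \<le> prob_Gnp n p (\<lambda>G. \<exists>k\<in>J. bad k G)"
    proof (rule prob_Gnp_mono)
      fix E assume E: "E \<subseteq> all_pairs n" "\<not> client_wins b H ({0..<n}, E)"
      show "\<exists>k\<in>J. bad k ({0..<n}, E)"
      proof (rule ccontr)
        assume "\<not> ?thesis"
        then have "\<forall>k\<in>J. \<exists>f. f \<in> Pi\<^sub>E (V k) (S k) \<and> (\<forall>a\<in>edges (T (fst k)). f ` a \<in> E)"
          unfolding bad_def edges_pair by blast
        from bchoice[OF this] obtain \<phi> where \<phi>: "\<forall>k\<in>J. \<phi> k \<in> Pi\<^sub>E (V k) (S k) \<and> (\<forall>a\<in>edges (T (fst k)). \<phi> k ` a \<in> E)"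
          by (rule exE)
        have mem: "\<phi> k i \<in> S k i" if "k \<in> J" "i \<in> V k" for k i
          using bspec[OF \<phi> that(1)] that(2) by auto
        have "client_wins b H ({0..<n}, E)"
        proof (rule N[rule_format, of "({0..<n}, E)" \<phi>], unfold verts_pair edges_pair, fold J_def V_def,
            intro conjI ballI)
          show "disjoint_family_on (\<lambda>k. \<phi> k ` V k) J"
            unfolding disjoint_family_on_def
          proof (intro ballI impI)
            fix k k' assume kk: "k \<in> J" "k' \<in> J" "k \<noteq> k'"
            show "\<phi> k ` V k \<inter> \<phi> k' ` V k' = {}"
            proof (rule ccontr)
              assume "\<not> ?thesis"
              then obtain i i' where i: "i \<in> V k" "i' \<in> V k'" "\<phi> k i = \<phi> k' i'" by auto
              then show False using S_disj[OF kk(1) i(1) kk(2) i(2) mem[OF kk(1) i(1)]] mem[OF kk(2) i(2)] kk(3)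
                by simp
            qed
          qed
          fix k assume k: "k \<in> J"
          show "inj_on (\<phi> k) (V k)"
          proof (rule inj_onI)
            fix i i' assume i: "i \<in> V k" "i' \<in> V k" "\<phi> k i = \<phi> k i'"
            then show "i = i'" using S_disj[OF k i(1) k i(2) mem[OF k i(1)]] mem[OF k i(2)] by simp
          qed
          show "\<phi> k ` V k \<subseteq> {0..<n}" using mem[OF k] S_sub[OF k] by blast
          show "\<phi> k ` a \<in> E" if "a \<in> edges (T (fst k))" for a using bspec[OF \<phi> k] that by simp
        qed simp
        then show False using E(2) by simp
      qed
    qed (use p in auto)
    also have "\<dots> \<le> (\<Sum>k\<in>J. prob_Gnp n p (bad k))"
      using p by (intro prob_Gnp_union_bound finJ) auto
    also have "\<dots> \<le> (\<Sum>k\<in>J. 2 ^ v / q)"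
    proof (rule sum_mono)
      fix k assume k: "k \<in> J"
      then have C: "fst k \<in> components H" by (auto simp: J_def)
      have "prob_Gnp n p (bad k) \<le> 2 ^ card (V k) / q"
        unfolding bad_def
      proof (rule prob_no_transversal_copy[where m = m])
        show "leaf_grown (V k) (edges (T (fst k)))"
          unfolding V_def using T[OF C] by (intro is_tree_leaf_grown) simp
        show "disjoint_family_on (S k) (V k)"
          using S_disj[OF k _ k] unfolding disjoint_family_on_def by blast
        show "S k i \<subseteq> {0..<n} \<and> card (S k i) = m" if "i \<in> V k" for i
          using S_sub[OF k that] by (simp add: S_def)
        show "q \<le> real m ^ l * p ^ (l - 1)" if "1 \<le> l" "l \<le> card (V k)" for l
          using q(2) that T[OF C] unfolding m_def V_def by simp
      qed (use p q in auto)
      also have "\<dots> \<le> 2 ^ v / q"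
        using q(1) T[OF C] by (intro divide_right_mono power_increasing) (auto simp: V_def)
      finally show "prob_Gnp n p (bad k) \<le> 2 ^ v / q" .
    qed
    also have "\<dots> = real (card J) * 2 ^ v / q" by simp
    finally show ?thesis unfolding prob_Gnp_not by linarith
  qed
  then show ?thesis by (intro exI[of _ "card J"] exI[of _ L]) (simp add: L_def)
qed

subsection \<open>Both sides of the threshold\<close>

text \<open>The right-hand side is \<open>m * (m * p) ^ (k - 1)\<close>, which is monotone in
  \<open>k\<close>: it increases if \<open>m * p \<ge> 1\<close> and decreases otherwise, so one of
  the ends \<open>k = 1\<close> and \<open>k = v\<close> is the smallest.\<close>

lemma power_mult_power_ge_min:
  fixes m p :: real
  assumes "0 \<le> m" "0 \<le> p" "1 \<le> k" "k \<le> v"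
  shows "min m (m ^ v * p ^ (v - 1)) \<le> m ^ k * p ^ (k - 1)"
proof -
  have eq: "m ^ j * p ^ (j - 1) = m * (m * p) ^ (j - 1)" if "1 \<le> j" for j
    using that by (cases j) (auto simp: power_mult_distrib)
  show ?thesis
  proof (cases "1 \<le> m * p")
    case True
    then have "m * 1 \<le> m * (m * p) ^ (k - 1)" using assms by (intro mult_left_mono one_le_power) auto
    then show ?thesis using eq[OF assms(3)] by simp
  next
    case False
    then have "m * (m * p) ^ (v - 1) \<le> m * (m * p) ^ (k - 1)"
      using assms by (intro mult_left_mono power_decreasing) auto
    then show ?thesis using eq[of k] eq[of v] assms by simp
  qed
qed

text \<open>\<open>r\<close> measures \<open>p\<close> in units of the threshold. Up to constants
  the expected number of copies of a tree with \<open>v\<close> vertices and \<open>e\<close> edges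
  is then just \<open>r ^ e\<close>.\<close>

lemma powr_scaled:
  fixes p :: real
  assumes "0 < n" "0 < e" "r = p / real n powr (- (real v / real e))"
  shows "real n ^ v * p ^ e = r ^ e"
proof -
  have "r = p * real n powr (real v / real e)" using assms by (simp add: powr_minus divide_inverse)
  then have "r ^ e = p ^ e * (real n powr (real v / real e)) ^ e" by (simp add: power_mult_distrib)
  also have "(real n powr (real v / real e)) ^ e = real n powr (real v)"
    using assms by (simp add: powr_power)
  also have "\<dots> = real n ^ v" using assms by (simp add: powr_realpow)
  finally show ?thesis by simp
qed

lemma Waiter_wins_below_threshold:
  fixes p :: "nat \<Rightarrow> real"
  assumes "is_forest H" "is_Tmax b H T" "v = card (verts T)" "2 \<le> v" "e = v - 1"
    and p: "\<And>n. 0 \<le> p n \<and> p n \<le> 1" "p \<in> o(\<lambda>n. real n powr (- (real v / real e)))"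
  shows "(\<lambda>n. prob_Gnp n (p n) (\<lambda>G. \<not> client_wins b H G)) \<longlonglongrightarrow> 1"
proof -
  define r where "r n = p n / real n powr (- (real v / real e))" for n
  have r0: "r \<longlonglongrightarrow> 0" unfolding r_def by (rule smalloD_tendsto[OF p(2)])
  let ?k = "\<lambda>l. if l = v then v - 1 else l"
  let ?t = "\<lambda>l n. 2 ^ 2 ^ l * (real n ^ l * p n ^ ?k l)"
  have e: "0 < e" "e \<le> v" using assms by auto
  have t0: "?t l \<longlonglongrightarrow> 0" if l: "l \<in> {1..v}" for l
  proof -
    have "(\<lambda>n. 2 ^ 2 ^ l * r n ^ ?k l) \<longlonglongrightarrow> 2 ^ 2 ^ l * 0 ^ ?k l"
      by (intro tendsto_intros r0)
    \<comment> \<open>Here \<open>v \<ge> 2\<close> enters: with exponent 0 the bound would stay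
      constant instead of vanishing.\<close>
    moreover have "?k l \<noteq> 0" using l assms by auto
    ultimately have lim: "(\<lambda>n. 2 ^ 2 ^ l * r n ^ ?k l) \<longlonglongrightarrow> 0" by (simp add: power_0_left)
    have "real n ^ l * p n ^ ?k l \<le> r n ^ ?k l" if n: "0 < n" for n
    proof (cases "l = v")
      case True
      then show ?thesis using powr_scaled[OF n e(1) r_def[of n]] assms(5) by simp
    next
      case False
      \<comment> \<open>As \<open>v / e\<close> is at least 1, \<open>n * p\<close> is at most
        \<open>r\<close>. The terms with \<open>l < v\<close> are powers of \<open>n * p\<close>, so
        they vanish along with \<open>r\<close>.\<close>
      have "real n = real n powr 1" using n by simp
      also have "\<dots> \<le> real n powr (real v / real e)" using n e by (intro powr_mono) auto
      finally have "p n * real n \<le> p n * real n powr (real v / real e)"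
        using p(1)[of n] by (intro mult_left_mono) auto
      then have "real n * p n \<le> r n"
        by (simp add: r_def powr_minus divide_inverse mult.commute)
      then have "(real n * p n) ^ l \<le> r n ^ l" using p(1)[of n] by (intro power_mono) auto
      then show ?thesis using False by (simp add: power_mult_distrib)
    qed
    then have "\<forall>\<^sub>F n in sequentially. ?t l n \<le> 2 ^ 2 ^ l * r n ^ ?k l"
      by (intro eventually_sequentiallyI[of 1]) (auto intro!: mult_left_mono)
    moreover have "0 \<le> ?t l n" for n using p(1)[of n] by simp
    ultimately show ?thesis by (intro tendsto_sandwich[OF _ _ tendsto_const lim]) auto
  qed
  have "(\<lambda>n. 1 - (\<Sum>l\<in>{1..v}. ?t l n)) \<longlonglongrightarrow> 1 - (\<Sum>l\<in>{1..v}. 0)"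
    by (intro tendsto_diff tendsto_const tendsto_sum t0)
  then have lim: "(\<lambda>n. 1 - (\<Sum>l\<in>{1..v}. ?t l n)) \<longlonglongrightarrow> 1" by simp
  show ?thesis
  proof (rule tendsto_sandwich[OF _ _ lim tendsto_const])
    show "\<forall>\<^sub>F n in sequentially. 1 - (\<Sum>l\<in>{1..v}. ?t l n) \<le> prob_Gnp n (p n) (\<lambda>G. \<not> client_wins b H G)"
      using prob_not_client_wins_ge[OF assms(1,2,3)] assms(4) p(1) by (intro always_eventually allI) auto
    show "\<forall>\<^sub>F n in sequentially. prob_Gnp n (p n) (\<lambda>G. \<not> client_wins b H G) \<le> 1"
      using p(1) by (intro always_eventually allI prob_Gnp_le_1) auto
  qed
qed

lemma Client_wins_above_threshold:
  fixes p :: "nat \<Rightarrow> real"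
  assumes "is_forest H" "is_Tmax b H T" "v = card (verts T)" "2 \<le> v" "e = v - 1"
    and p: "\<And>n. 0 \<le> p n \<and> p n \<le> 1" "p \<in> \<omega>(\<lambda>n. real n powr (- (real v / real e)))"
  shows "(\<lambda>n. prob_Gnp n (p n) (client_wins b H)) \<longlonglongrightarrow> 1"
proof -
  have wf: "wf_graph H" using assms(1) by (simp add: is_forest_def)
  obtain M where M: "\<And>C. C \<in> components H \<Longrightarrow> min_client_tree b (induced H C) (M C)"
    using ex_min_client_trees[OF assms(1), where b = b] by metis
  have "\<And>C. C \<in> components H \<Longrightarrow> is_tree (M C) \<and> client_wins b (induced H C) (M C) \<and> card (verts (M C)) \<le> v"
    using M card_le_Tmax[OF assms(2) _ M] assms(3) unfolding min_client_tree_def by blast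
  then have "\<exists>(K :: nat) (L :: nat). 0 < L \<and> (\<forall>n (p :: real) q. 0 < p \<and> p \<le> 1 \<and> 0 < q \<and>
      (\<forall>k. 1 \<le> k \<and> k \<le> v \<longrightarrow> q \<le> real (n div L) ^ k * p ^ (k - 1)) \<longrightarrow>
      1 - real K * 2 ^ v / q \<le> prob_Gnp n p (client_wins b H))"
    by (rule prob_client_wins_ge[OF wf])
  then obtain K L :: nat where L: "0 < L"
    and KL: "\<forall>n (p :: real) q. 0 < p \<and> p \<le> 1 \<and> 0 < q \<and>
      (\<forall>k. 1 \<le> k \<and> k \<le> v \<longrightarrow> q \<le> real (n div L) ^ k * p ^ (k - 1)) \<longrightarrow>
      1 - real K * 2 ^ v / q \<le> prob_Gnp n p (client_wins b H)"
    by (elim exE conjE)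
  define r where "r n = p n / real n powr (- (real v / real e))" for n
  have e: "0 < e" using assms by auto
  have rlim: "filterlim r at_top sequentially"
  proof -
    have "\<forall>\<^sub>F n in sequentially. real n powr (- (real v / real e)) \<noteq> 0"
      by (intro eventually_sequentiallyI[of 1]) auto
    then have "filterlim (\<lambda>n. norm (r n)) at_top sequentially"
      unfolding r_def by (rule smallomegaD_filterlim_at_top_norm[OF p(2)])
    moreover have "norm (r n) = r n" for n using p(1)[of n] by (simp add: r_def)
    ultimately show ?thesis by simp
  qed
  \<comment> \<open>The two entries bound from below the extremes \<open>m\<close> and
    \<open>m ^ v * p ^ (v - 1)\<close> for \<open>m = n div L\<close>, using that \<open>m\<close>
    is at least \<open>n / (2 * L)\<close> once \<open>n \<ge> 2 * L\<close>. Both tend to infinity,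
    which drives the error \<open>K * 2 ^ v / q\<close> to 0.\<close>
  define q where "q n = min (real n / (2 * real L)) (r n ^ e / (2 * real L) ^ v)" for n
  have qlim: "filterlim q at_top sequentially"
  proof -
    have "filterlim (\<lambda>n. real n / (2 * real L)) at_top sequentially"
      using L by (intro filterlim_tendsto_pos_mult_at_top[OF tendsto_const _ filterlim_real_sequentially,
            of "1 / (2 * real L)", simplified]) auto
    moreover have "filterlim (\<lambda>n. r n ^ e / (2 * real L) ^ v) at_top sequentially"
      using filterlim_tendsto_pos_mult_at_top[OF tendsto_const _ filterlim_pow_at_top[OF e rlim],
          of "1 / (2 * real L) ^ v"] L by simp
    ultimately show ?thesis unfolding q_def filterlim_at_top by (simp add: eventually_conj_iff)
  qed
  have "(\<lambda>n. 1 - real K * 2 ^ v / q n) \<longlonglongrightarrow> 1 - 0"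
    by (intro tendsto_diff tendsto_const tendsto_divide_0[OF tendsto_const]
        filterlim_at_top_imp_at_infinity qlim)
  then have lim: "(\<lambda>n. 1 - real K * 2 ^ v / q n) \<longlonglongrightarrow> 1" by simp
  have main: "1 - real K * 2 ^ v / q n \<le> prob_Gnp n (p n) (client_wins b H)"
    if n: "2 * L \<le> n" and rn: "0 < r n" and qn: "0 < q n" for n
  proof (rule KL[rule_format], intro conjI allI impI)
    have n0: "0 < n" using n L by linarith
    show pn: "0 < p n" using rn p(1)[of n] by (cases "p n = 0") (auto simp: r_def)
    show "p n \<le> 1" "0 < q n" using p(1) qn by auto
    fix k assume k: "1 \<le> k \<and> k \<le> v"
    define m where "m = real (n div L)"
    have "real n / (2 * real L) \<le> m"
    proof -
      have "n < L + L * (n div L)" using L by (rule dividend_less_times_div)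
      then have "n \<le> 2 * (L * (n div L))" using n by linarith
      then have "n \<le> (n div L) * (2 * L)" by (simp add: mult_ac)
      then have "real n \<le> m * (2 * real L)" unfolding m_def by (metis of_nat_le_iff of_nat_mult of_nat_numeral)
      then show ?thesis using L by (simp add: divide_le_eq)
    qed
    moreover have "r n ^ e / (2 * real L) ^ v \<le> m ^ v * p n ^ (v - 1)"
    proof -
      have "r n ^ e / (2 * real L) ^ v = (real n / (2 * real L)) ^ v * p n ^ e"
        using powr_scaled[OF n0 e r_def[of n]] by (simp add: power_divide)
      also have "\<dots> \<le> m ^ v * p n ^ e"
        using \<open>real n / (2 * real L) \<le> m\<close> pn by (intro mult_right_mono power_mono) auto
      finally show ?thesis using assms(5) by simp
    qed
    ultimately have "q n \<le> min m (m ^ v * p n ^ (v - 1))" unfolding q_def by (rule min.mono)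
    also have "\<dots> \<le> m ^ k * p n ^ (k - 1)"
      using k pn by (intro power_mult_power_ge_min) (auto simp: m_def)
    finally show "q n \<le> real (n div L) ^ k * p n ^ (k - 1)" by (simp add: m_def)
  qed
  show ?thesis
  proof (rule tendsto_sandwich[OF _ _ lim tendsto_const])
    have "\<forall>\<^sub>F n in sequentially. 2 * L \<le> n" by (rule eventually_ge_at_top)
    moreover have "\<forall>\<^sub>F n in sequentially. 0 < r n" using rlim by (simp add: filterlim_at_top_dense)
    moreover have "\<forall>\<^sub>F n in sequentially. 0 < q n" using qlim by (simp add: filterlim_at_top_dense)
    ultimately show "\<forall>\<^sub>F n in sequentially. 1 - real K * 2 ^ v / q n \<le> prob_Gnp n (p n) (client_wins b H)"
      by eventually_elim (rule main)
    show "\<forall>\<^sub>F n in sequentially. prob_Gnp n (p n) (client_wins b H) \<le> 1"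
      using p(1) by (intro always_eventually allI prob_Gnp_le_1) auto
  qed
qed

theorem theorem10:
  fixes H :: "'a graph" and b :: nat
  assumes "is_forest H" and "b \<ge> 1"
  shows "(is_tree H \<longrightarrow> (\<exists>T::nat graph. is_tree T \<and> client_wins b H T))
    \<and> (edges H \<noteq> {} \<longrightarrow>
         (\<exists>T. is_Tmax b H T) \<and>
         (\<forall>T. is_Tmax b H T \<longrightarrow>
            (let v = real (card (verts T)); e = real (card (edges T)) in
             \<forall>p :: nat \<Rightarrow> real. (\<forall>n. 0 \<le> p n \<and> p n \<le> 1) \<longrightarrow>
               (p \<in> \<omega>(\<lambda>n. real n powr (- (v / e))) \<longrightarrow>
                  (\<lambda>n. prob_Gnp n (p n) (client_wins b H)) \<longlonglongrightarrow> 1) \<and>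
               (p \<in> o(\<lambda>n. real n powr (- (v / e))) \<longrightarrow>
                  (\<lambda>n. prob_Gnp n (p n) (\<lambda>G. \<not> client_wins b H G)) \<longlonglongrightarrow> 1))))"
proof (intro conjI impI)
  show "\<exists>T::nat graph. is_tree T \<and> client_wins b H T" if "is_tree H"
    using that by (rule tree_client_wins)
  assume H: "edges H \<noteq> {}"
  have "verts H \<noteq> {}" using H assms(1) by (auto simp: is_forest_def wf_graph_def)
  then show "\<exists>T. is_Tmax b H T" by (rule ex_Tmax[OF assms(1)])
  show "\<forall>T. is_Tmax b H T \<longrightarrow>
            (let v = real (card (verts T)); e = real (card (edges T)) in
             \<forall>p :: nat \<Rightarrow> real. (\<forall>n. 0 \<le> p n \<and> p n \<le> 1) \<longrightarrow>
               (p \<in> \<omega>(\<lambda>n. real n powr (- (v / e))) \<longrightarrow>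
                  (\<lambda>n. prob_Gnp n (p n) (client_wins b H)) \<longlonglongrightarrow> 1) \<and>
               (p \<in> o(\<lambda>n. real n powr (- (v / e))) \<longrightarrow>
                  (\<lambda>n. prob_Gnp n (p n) (\<lambda>G. \<not> client_wins b H G)) \<longlonglongrightarrow> 1))"
    unfolding Let_def
  proof (intro allI impI)
    fix T and p :: "nat \<Rightarrow> real"
    assume T: "is_Tmax b H T" and p: "\<forall>n. 0 \<le> p n \<and> p n \<le> 1"
    have "is_tree T" using T by (auto simp: is_Tmax_def min_client_tree_def)
    then have e: "card (edges T) = card (verts T) - 1"
      using leaf_grown_card[OF is_tree_leaf_grown, of T] by simp
    note two = Tmax_card_ge_2[OF assms(1) H T]
    show "(p \<in> \<omega>(\<lambda>n. real n powr (- (real (card (verts T)) / real (card (edges T))))) \<longrightarrow>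
        (\<lambda>n. prob_Gnp n (p n) (client_wins b H)) \<longlonglongrightarrow> 1) \<and>
      (p \<in> o(\<lambda>n. real n powr (- (real (card (verts T)) / real (card (edges T))))) \<longrightarrow>
        (\<lambda>n. prob_Gnp n (p n) (\<lambda>G. \<not> client_wins b H G)) \<longlonglongrightarrow> 1)"
      using Client_wins_above_threshold[OF assms(1) T refl two e spec[OF p]]
        Waiter_wins_below_threshold[OF assms(1) T refl two e spec[OF p]] by (intro conjI impI)
  qed
qed

end
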